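(* Let $p$ be a prime, $G$ a finite $p$-group and $R$ a commutative ring with $pR=0$. Suppose $S/R$ is Galois with group $G$. Then $S\cong R[G]$ as $R[G]$-modules.
   Context: For a finite group $G$, a commutative ring extension $S/R$ with $G$ acting by $R$-automorphisms is Galois with group $G$ if $S$ is finitely generated projective over $R$ and $S\otimes_RS\to\bigoplus_{g\in G}S$, $s\otimes s'\mapsto(s\,g(s'))_g$, is an isomorphism. $R[G]$ is the group ring. *)

theory Defs
  imports "HOL-Algebra.Algebra" "HOL-Computational_Algebra.Primes"
begin

section \<open>Linear maps\<close>

text \<open>The scalars may form a noncommutative ring (such as a group ring), so these notions are
  stated for the raw module records; the locale \<^locale>\<open>module\<close> of the library requires
  commutative scalars.\<close>

definition mod_hom ::
  "('a, 'k) ring_scheme \<Rightarrow> ('a, 'b, 'm) module_scheme \<Rightarrow> ('a, 'c, 'n) module_scheme \<Rightarrow> ('b \<Rightarrow> 'c) set"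
where
  "mod_hom A M N =
    {f. f \<in> carrier M \<rightarrow> carrier N
      \<and> (\<forall>x\<in>carrier M. \<forall>y\<in>carrier M. f (x \<oplus>\<^bsub>M\<^esub> y) = f x \<oplus>\<^bsub>N\<^esub> f y)
      \<and> (\<forall>a\<in>carrier A. \<forall>x\<in>carrier M. f (a \<odot>\<^bsub>M\<^esub> x) = a \<odot>\<^bsub>N\<^esub> f x)}"

definition mod_iso ::
  "('a, 'k) ring_scheme \<Rightarrow> ('a, 'b, 'm) module_scheme \<Rightarrow> ('a, 'c, 'n) module_scheme \<Rightarrow> ('b \<Rightarrow> 'c) set"
where
  "mod_iso A M N = {f \<in> mod_hom A M N. bij_betw f (carrier M) (carrier N)}"

definition isomorphic_modules ::
  "('a, 'k) ring_scheme \<Rightarrow> ('a, 'b, 'm) module_scheme \<Rightarrow> ('a, 'c, 'n) module_scheme \<Rightarrow> bool"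
where
  "isomorphic_modules A M N \<longleftrightarrow> mod_iso A M N \<noteq> {}"


section \<open>Constructions of modules\<close>

text \<open>The record type of modules extends that of rings.  Where a module carries no ring
  multiplication, the fields \<^const>\<open>monoid.mult\<close> and \<^const>\<open>monoid.one\<close> are left
  undefined; they play no role.\<close>

definition regular_module :: "('a, 'k) ring_scheme \<Rightarrow> ('a, 'a) module" where
  "regular_module A =
    \<lparr>carrier = carrier A, monoid.mult = monoid.mult A, one = one A,
     ring.zero = ring.zero A, ring.add = ring.add A, smult = monoid.mult A\<rparr>"

definition direct_sum_module ::
  "'i set \<Rightarrow> ('i \<Rightarrow> ('a, 'b, 'm) module_scheme) \<Rightarrow> ('a, 'i \<Rightarrow> 'b) module"
where
  "direct_sum_module I M =
    \<lparr>carrier = {f \<in> (\<Pi>\<^sub>E i\<in>I. carrier (M i)). finite {i \<in> I. f i \<noteq> \<zero>\<^bsub>M i\<^esub>}},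
     monoid.mult = undefined, one = undefined,
     ring.zero = (\<lambda>i\<in>I. \<zero>\<^bsub>M i\<^esub>),
     ring.add = (\<lambda>f g. \<lambda>i\<in>I. f i \<oplus>\<^bsub>M i\<^esub> g i),
     smult = (\<lambda>a f. \<lambda>i\<in>I. a \<odot>\<^bsub>M i\<^esub> f i)\<rparr>"

definition free_module :: "('a, 'k) ring_scheme \<Rightarrow> 'x set \<Rightarrow> ('a, 'x \<Rightarrow> 'a) module" where
  "free_module R B = direct_sum_module B (\<lambda>_. regular_module R)"

definition basis_vector :: "('a, 'k) ring_scheme \<Rightarrow> 'x set \<Rightarrow> 'x \<Rightarrow> ('x \<Rightarrow> 'a)" where
  "basis_vector R B x = (\<lambda>y\<in>B. if y = x then \<one>\<^bsub>R\<^esub> else \<zero>\<^bsub>R\<^esub>)"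

definition module_span ::
  "('a, 'k) ring_scheme \<Rightarrow> ('a, 'b, 'm) module_scheme \<Rightarrow> 'b set \<Rightarrow> 'b set"
where
  "module_span R M A = \<Inter>{H. submodule H R M \<and> A \<subseteq> H}"

text \<open>For a submodule \<open>N\<close>, the union below is the single coset \<open>N + a x\<close>, for any
  representative \<open>x\<close>.\<close>

definition quotient_module ::
  "('a, 'b, 'm) module_scheme \<Rightarrow> 'b set \<Rightarrow> ('a, 'b set) module"
where
  "quotient_module M N =
    \<lparr>carrier = a_rcosets\<^bsub>M\<^esub> N, monoid.mult = undefined, one = undefined,
     ring.zero = N, ring.add = (\<lambda>B C. B <+>\<^bsub>M\<^esub> C),
     smult = (\<lambda>a B. \<Union>x\<in>B. N +>\<^bsub>M\<^esub> (a \<odot>\<^bsub>M\<^esub> x))\<rparr>"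


section \<open>Finitely generated and projective modules\<close>

definition finitely_generated_module ::
  "('a, 'k) ring_scheme \<Rightarrow> ('a, 'b, 'm) module_scheme \<Rightarrow> bool"
where
  "finitely_generated_module R M \<longleftrightarrow>
    (\<exists>A. finite A \<and> A \<subseteq> carrier M \<and> module_span R M A = carrier M)"

text \<open>Projective means being a direct summand of a free module, given by an inclusion \<open>i\<close>
  and a retraction \<open>q\<close>.  Restricting to bases of the free module drawn from the element type
  of \<open>M\<close> is no loss: \<open>M\<close> is a quotient of the free module on the set \<open>carrier M\<close>, and if
  \<open>M\<close> is projective over any basis, this quotient splits.\<close>

definition projective_module ::
  "('a, 'k) ring_scheme \<Rightarrow> ('a, 'b, 'm) module_scheme \<Rightarrow> bool"
where
  "projective_module R M \<longleftrightarrow>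
    (\<exists>B :: 'b set. \<exists>i \<in> mod_hom R M (free_module R B). \<exists>q \<in> mod_hom R (free_module R B) M.
      \<forall>x\<in>carrier M. q (i x) = x)"


section \<open>Tensor products\<close>

definition tensor_relations ::
  "('a, 'k) ring_scheme \<Rightarrow> ('a, 'b, 'm) module_scheme \<Rightarrow> ('a, 'c, 'n) module_scheme
    \<Rightarrow> ('b \<times> 'c \<Rightarrow> 'a) set"
where
  "tensor_relations R M N =
    (let F = free_module R (carrier M \<times> carrier N);
         e = (\<lambda>x y. basis_vector R (carrier M \<times> carrier N) (x, y))
     in {e (x \<oplus>\<^bsub>M\<^esub> x') y \<ominus>\<^bsub>F\<^esub> (e x y \<oplus>\<^bsub>F\<^esub> e x' y) | x x' y.
            x \<in> carrier M \<and> x' \<in> carrier M \<and> y \<in> carrier N}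
      \<union> {e x (y \<oplus>\<^bsub>N\<^esub> y') \<ominus>\<^bsub>F\<^esub> (e x y \<oplus>\<^bsub>F\<^esub> e x y') | x y y'.
            x \<in> carrier M \<and> y \<in> carrier N \<and> y' \<in> carrier N}
      \<union> {e (a \<odot>\<^bsub>M\<^esub> x) y \<ominus>\<^bsub>F\<^esub> (a \<odot>\<^bsub>F\<^esub> e x y) | a x y.
            a \<in> carrier R \<and> x \<in> carrier M \<and> y \<in> carrier N}
      \<union> {e x (a \<odot>\<^bsub>N\<^esub> y) \<ominus>\<^bsub>F\<^esub> (a \<odot>\<^bsub>F\<^esub> e x y) | a x y.
            a \<in> carrier R \<and> x \<in> carrier M \<and> y \<in> carrier N})"

definition tensor_kernel ::
  "('a, 'k) ring_scheme \<Rightarrow> ('a, 'b, 'm) module_scheme \<Rightarrow> ('a, 'c, 'n) module_scheme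
    \<Rightarrow> ('b \<times> 'c \<Rightarrow> 'a) set"
where
  "tensor_kernel R M N =
    module_span R (free_module R (carrier M \<times> carrier N)) (tensor_relations R M N)"

definition tensor_module ::
  "('a, 'k) ring_scheme \<Rightarrow> ('a, 'b, 'm) module_scheme \<Rightarrow> ('a, 'c, 'n) module_scheme
    \<Rightarrow> ('a, ('b \<times> 'c \<Rightarrow> 'a) set) module"
where
  "tensor_module R M N =
    quotient_module (free_module R (carrier M \<times> carrier N)) (tensor_kernel R M N)"

definition pure_tensor ::
  "('a, 'k) ring_scheme \<Rightarrow> ('a, 'b, 'm) module_scheme \<Rightarrow> ('a, 'c, 'n) module_scheme
    \<Rightarrow> 'b \<Rightarrow> 'c \<Rightarrow> ('b \<times> 'c \<Rightarrow> 'a) set"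
where
  "pure_tensor R M N x y =
    tensor_kernel R M N +>\<^bsub>free_module R (carrier M \<times> carrier N)\<^esub>
      basis_vector R (carrier M \<times> carrier N) (x, y)"


section \<open>Galois extensions of commutative rings\<close>

text \<open>The extension is an algebra with injective structure map: without injectivity, the zero
  ring would be Galois over every \<open>R\<close>, with any group.  Since the pure tensors generate the
  tensor product, the map \<open>f\<close> in the last assumption is the unique linear one with
  \<open>f (s \<otimes> s') = (s g(s'))\<^sub>g\<close>.\<close>

locale galois_extension =
  fixes R :: "('r, 'k) ring_scheme"
    and S :: "('r, 's, 'm) module_scheme"
    and G :: "('g, 'l) monoid_scheme"
    and \<phi> :: "'g \<Rightarrow> 's \<Rightarrow> 's"
  assumes algebra: "algebra R S"
    and extension: "inj_on (\<lambda>r. r \<odot>\<^bsub>S\<^esub> \<one>\<^bsub>S\<^esub>) (carrier R)"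
    and finite_group: "finite (carrier G)"
    and action: "group_action G (carrier S) \<phi>"
    and action_ring_iso: "\<And>g. g \<in> carrier G \<Longrightarrow> \<phi> g \<in> ring_iso S S"
    and action_linear:
      "\<And>g r s. \<lbrakk>g \<in> carrier G; r \<in> carrier R; s \<in> carrier S\<rbrakk> \<Longrightarrow> \<phi> g (r \<odot>\<^bsub>S\<^esub> s) = r \<odot>\<^bsub>S\<^esub> \<phi> g s"
    and finitely_generated: "finitely_generated_module R S"
    and projective: "projective_module R S"
    and galois:
      "\<exists>f \<in> mod_iso R (tensor_module R S S) (direct_sum_module (carrier G) (\<lambda>_. S)).
        \<forall>s\<in>carrier S. \<forall>s'\<in>carrier S.
          f (pure_tensor R S S s s') = (\<lambda>g\<in>carrier G. s \<otimes>\<^bsub>S\<^esub> \<phi> g s')"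


section \<open>Group rings\<close>

text \<open>Both definitions below are meant for finite \<open>G\<close>: sums (\<^const>\<open>finsum\<close>) over
  infinite index sets are zero by convention.\<close>

definition group_ring :: "('r, 'k) ring_scheme \<Rightarrow> ('g, 'l) monoid_scheme \<Rightarrow> ('g \<Rightarrow> 'r) ring" where
  "group_ring R G =
    \<lparr>carrier = carrier (free_module R (carrier G)),
     monoid.mult = (\<lambda>a b. \<lambda>g\<in>carrier G.
       \<Oplus>\<^bsub>R\<^esub>h\<in>carrier G. a h \<otimes>\<^bsub>R\<^esub> b (inv\<^bsub>G\<^esub> h \<otimes>\<^bsub>G\<^esub> g)),
     one = basis_vector R (carrier G) \<one>\<^bsub>G\<^esub>,
     ring.zero = ring.zero (free_module R (carrier G)),
     ring.add = ring.add (free_module R (carrier G))\<rparr>"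

definition group_ring_module ::
  "('r, 's, 'm) module_scheme \<Rightarrow> ('g, 'l) monoid_scheme \<Rightarrow> ('g \<Rightarrow> 's \<Rightarrow> 's) \<Rightarrow> ('g \<Rightarrow> 'r, 's) module"
where
  "group_ring_module S G \<phi> =
    \<lparr>carrier = carrier S, monoid.mult = monoid.mult S, one = one S, ring.zero = ring.zero S,
     ring.add = ring.add S,
     smult = (\<lambda>a s. \<Oplus>\<^bsub>S\<^esub>g\<in>carrier G. a g \<odot>\<^bsub>S\<^esub> \<phi> g s)\<rparr>"

end

theory Submission
  imports Defs
begin

text \<open>
  Choose \<open>\<theta> \<in> S\<close> with trace \<open>1\<close>; then \<open>a \<mapsto> a \<theta>\<close> is an isomorphism \<open>R[G] \<rightarrow> S\<close>.  It is injective: a nonzero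
  kernel would contain a nonzero \<open>G\<close>-fixed element, as \<open>G\<close> is a \<open>p\<close>-group and \<open>pR = 0\<close>; this is
  \<open>r \<Sum>\<^sub>g g\<close> for some \<open>r \<in> R\<close>, and it maps to \<open>r tr(\<theta>) = r\<close>, so \<open>r = 0\<close>.  It is surjective: every \<open>x \<in> S\<close> is congruent to
  \<open>tr(x) \<theta>\<close> modulo \<open>IS\<close>, where \<open>I\<close> is the augmentation ideal, and \<open>I\<close> is nilpotent.  That
  \<open>S\<^sup>G = R\<close> and that the trace is onto \<open>R\<close> follow from the Galois isomorphism and the determinant trick.
\<close>

section \<open>Linear maps and free modules\<close>

text \<open>\<open>R\<close> is an arbitrary ring of characteristic \<open>p\<close>, not assumed
  finite, local or a field, so \<open>R[G]\<close> and \<open>S\<close> cannot be compared by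
  counting or by dimension. The p-group hypothesis enters through a single finite count: a proper
  \<open>G\<close>-stable subgroup \<open>W\<close> of a finite p-group \<open>V\<close> on which
  \<open>G\<close> acts by automorphisms has a number of cosets divisible by \<open>p\<close>, and
  as \<open>W\<close> itself is a fixed coset there must be another one. Left translation turns this
  into the fixed vector behind injectivity; right translation turns it into a Nakayama-type
  statement behind surjectivity. The element \<theta> serves both halves: it recovers
  \<open>r\<close> from \<open>r\<close> times the norm element, and it lets \<open>x\<close> be
  expanded as tr(\<theta>) \<open>x\<close>. The two inputs about \<open>S\<close>, that fixed
  elements are scalars and that the trace is onto, are statements over a ring. Each is obtained from
  an ideal \<open>J\<close> of \<open>R\<close> with \<open>J S = S\<close>: finite generation
  yields \<open>r\<close> in \<open>J\<close> with \<open>(1 - r) S = 0\<close>, and since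
  \<open>R\<close> embeds in \<open>S\<close> this forces \<open>r = 1\<close>.\<close>

lemma module_span_submodule:
  assumes "module R M" "A \<subseteq> carrier M"
  shows "submodule (module_span R M A) R M"
proof -
  interpret module R M by fact
  show ?thesis
    unfolding module_span_def
  proof (rule submoduleI)
    show "\<Inter> {H. submodule H R M \<and> A \<subseteq> H} \<subseteq> carrier M"
      using carrier_is_submodule assms by blast
    show "\<zero>\<^bsub>M\<^esub> \<in> \<Inter> {H. submodule H R M \<and> A \<subseteq> H}"
      using subgroup.one_closed submodule.axioms(1) by fastforce
  qed (simp_all add: submoduleE)
qed

lemma module_span_minimal:
  "submodule H R M \<Longrightarrow> A \<subseteq> H \<Longrightarrow> module_span R M A \<subseteq> H"
  unfolding module_span_def by blast

lemma module_span_superset: "A \<subseteq> module_span R M A"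
  unfolding module_span_def by blast

lemma (in module) submodule_zero: "submodule H R M \<Longrightarrow> \<zero>\<^bsub>M\<^esub> \<in> H"
  using subgroup.one_closed submodule.axioms(1) by fastforce

lemma (in module) submodule_finsum:
  assumes "submodule H R M" "\<And>i. i \<in> I \<Longrightarrow> f i \<in> H"
  shows "finsum M f I \<in> H"
  using assms(2)
proof (induction I rule: infinite_finite_induct)
  case (insert i I)
  have "f \<in> I \<rightarrow> carrier M" "f i \<in> carrier M"
    using insert submoduleE(1)[OF assms(1)] by blast+
  with insert show ?case
    using submoduleE(5)[OF assms(1)] by simp
qed (auto simp: submodule_zero assms)

lemma mod_homD:
  assumes "f \<in> mod_hom A M N"
  shows "x \<in> carrier M \<Longrightarrow> f x \<in> carrier N"
    and "x \<in> carrier M \<Longrightarrow> y \<in> carrier M \<Longrightarrow> f (x \<oplus>\<^bsub>M\<^esub> y) = f x \<oplus>\<^bsub>N\<^esub> f y"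
    and "a \<in> carrier A \<Longrightarrow> x \<in> carrier M \<Longrightarrow> f (a \<odot>\<^bsub>M\<^esub> x) = a \<odot>\<^bsub>N\<^esub> f x"
  using assms unfolding mod_hom_def by auto

lemma mod_hom_group_hom:
  assumes "module R M" "module R N" "f \<in> mod_hom R M N"
  shows "group_hom (add_monoid M) (add_monoid N) f"
proof -
  interpret M: module R M by fact
  interpret N: module R N by fact
  show ?thesis
    by unfold_locales (use assms(3) in \<open>auto simp: hom_def mod_hom_def\<close>)
qed

lemma mod_hom_zero:
  assumes "module R M" "module R N" "f \<in> mod_hom R M N"
  shows "f \<zero>\<^bsub>M\<^esub> = \<zero>\<^bsub>N\<^esub>"
  using group_hom.hom_one[OF mod_hom_group_hom[OF assms]] by simp

lemma mod_hom_minus: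
  assumes "module R M" "module R N" "f \<in> mod_hom R M N" "x \<in> carrier M" "y \<in> carrier M"
  shows "f (x \<ominus>\<^bsub>M\<^esub> y) = f x \<ominus>\<^bsub>N\<^esub> f y"
proof -
  interpret M: module R M by fact
  interpret N: module R N by fact
  have "f (\<ominus>\<^bsub>M\<^esub> y) = \<ominus>\<^bsub>N\<^esub> f y"
    using group_hom.hom_inv[OF mod_hom_group_hom[OF assms(1-3)]] assms(5)
    by (simp add: a_inv_def)
  then show ?thesis
    using assms(4,5) mod_homD(2)[OF assms(3)] by (simp add: a_minus_def)
qed

lemma mod_hom_vimage_submodule:
  assumes "module R M" "module R N" "f \<in> mod_hom R M N" "submodule H R N"
  shows "submodule {x \<in> carrier M. f x \<in> H} R M"
proof -
  interpret M: module R M by fact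
  interpret N: module R N by fact
  note H = N.submoduleE[OF assms(4)] and f = mod_homD[OF assms(3)]
  show ?thesis
  proof (rule M.submoduleI)
    fix x assume "x \<in> {x \<in> carrier M. f x \<in> H}"
    then show "\<ominus>\<^bsub>M\<^esub> x \<in> {x \<in> carrier M. f x \<in> H}"
      using f(3)[of "\<ominus>\<^bsub>R\<^esub> \<one>\<^bsub>R\<^esub>" x] H(4)[of "\<ominus>\<^bsub>R\<^esub> \<one>\<^bsub>R\<^esub>" "f x"]
      by (simp add: M.smult_l_minus)
  qed (use f H mod_hom_zero[OF assms(1-3)] N.submodule_zero[OF assms(4)] in auto)
qed

lemma mod_hom_finsum:
  assumes "module R M" "module R N" "f \<in> mod_hom R M N" "h \<in> I \<rightarrow> carrier M"
  shows "f (finsum M h I) = finsum N (\<lambda>i. f (h i)) I"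
proof -
  interpret M: module R M by fact
  interpret N: module R N by fact
  note f = mod_homD[OF assms(3)]
  show ?thesis
    using assms(4)
  proof (induction I rule: infinite_finite_induct)
    case (insert i I)
    then have "h \<in> I \<rightarrow> carrier M" "h i \<in> carrier M" "(\<lambda>i. f (h i)) \<in> I \<rightarrow> carrier N"
      "f (h i) \<in> carrier N" "finsum M h I \<in> carrier M"
      using f(1) by (auto simp: Pi_iff)
    with insert f(2) show ?case by simp
  qed (simp_all add: mod_hom_zero[OF assms(1-3)])
qed

section \<open>Regular modules, direct sums and free modules\<close>

lemma regular_module_simps [simp]:
  "carrier (regular_module A) = carrier A"
  "ring.add (regular_module A) = ring.add A"
  "ring.zero (regular_module A) = ring.zero A"
  "module.smult (regular_module A) = monoid.mult A"
  by (simp_all add: regular_module_def)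

lemma (in cring) module_regular: "module R (regular_module R)"
proof (rule moduleI)
  show "abelian_group (regular_module R)"
    by (rule abelian_groupI)
      (auto simp: a_ac intro: bexI[of _ "\<ominus> x" for x] l_neg)
qed (auto simp: is_cring l_distr r_distr m_assoc)

lemma direct_sum_module_simps:
  "f \<in> carrier (direct_sum_module I M) \<longleftrightarrow>
    f \<in> (\<Pi>\<^sub>E i\<in>I. carrier (M i)) \<and> finite {i \<in> I. f i \<noteq> \<zero>\<^bsub>M i\<^esub>}"
  "ring.zero (direct_sum_module I M) = (\<lambda>i\<in>I. \<zero>\<^bsub>M i\<^esub>)"
  "f \<oplus>\<^bsub>direct_sum_module I M\<^esub> g = (\<lambda>i\<in>I. f i \<oplus>\<^bsub>M i\<^esub> g i)"
  "a \<odot>\<^bsub>direct_sum_module I M\<^esub> f = (\<lambda>i\<in>I. a \<odot>\<^bsub>M i\<^esub> f i)"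
  by (simp_all add: direct_sum_module_def)

lemma module_direct_sum:
  assumes "cring R" and M: "\<And>i. i \<in> I \<Longrightarrow> module R (M i)"
  shows "module R (direct_sum_module I M)"
proof -
  interpret cring R by fact
  have ag: "abelian_group (M i)" if "i \<in> I" for i
    using M[OF that] by (rule module.axioms(2))
  have am: "abelian_monoid (M i)" if "i \<in> I" for i
    using ag[OF that] by (rule abelian_group.axioms(1))
  have neg0: "\<ominus>\<^bsub>M i\<^esub> \<zero>\<^bsub>M i\<^esub> = \<zero>\<^bsub>M i\<^esub>" if "i \<in> I" for i
    using monoid.inv_one[OF group.is_monoid[OF abelian_group.a_group[OF ag[OF that]]]] by (simp add: a_inv_def)
  let ?D = "direct_sum_module I M"
  have mem: "f i \<in> carrier (M i)" if "f \<in> carrier ?D" "i \<in> I" for f i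
    using that by (auto simp: direct_sum_module_simps)
  have ext: "f \<in> extensional I" if "f \<in> carrier ?D" for f
    using that by (auto simp: direct_sum_module_simps PiE_def)
  have fin: "finite {i \<in> I. f i \<noteq> \<zero>\<^bsub>M i\<^esub>}" if "f \<in> carrier ?D" for f
    using that by (auto simp: direct_sum_module_simps)
  have eqI: "f = g" if "f \<in> extensional I" "g \<in> extensional I" "\<And>i. i \<in> I \<Longrightarrow> f i = g i" for f g :: "'c \<Rightarrow> 'd"
    using that by (rule extensionalityI)
  \<comment> \<open>\<open>J\<close> is any finite set outside which \<open>h\<close> vanishes, so
    the exact support of a sum or a multiple never has to be computed.\<close>
  have carrierI: "(\<lambda>i\<in>I. h i) \<in> carrier ?D"
    if "\<And>i. i \<in> I \<Longrightarrow> h i \<in> carrier (M i)" "finite J" "\<And>i. i \<in> I \<Longrightarrow> i \<notin> J \<Longrightarrow> h i = \<zero>\<^bsub>M i\<^esub>" for h J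
    using that(1) finite_subset[OF _ that(2), of "{i \<in> I. h i \<noteq> \<zero>\<^bsub>M i\<^esub>}"] that(3)
    by (auto simp: direct_sum_module_simps cong: conj_cong)
  have add: "f \<oplus>\<^bsub>?D\<^esub> g \<in> carrier ?D" if "f \<in> carrier ?D" "g \<in> carrier ?D" for f g
    unfolding direct_sum_module_simps(3)
    by (rule carrierI[OF _ finite_UnI[OF fin[OF that(1)] fin[OF that(2)]]])
      (auto simp: mem that abelian_monoid.a_closed[OF am] abelian_monoid.l_zero[OF am] abelian_monoid.zero_closed[OF am])
  have zero: "\<zero>\<^bsub>?D\<^esub> \<in> carrier ?D"
    unfolding direct_sum_module_simps(2)
    by (rule carrierI[of _ "{}"]) (auto simp: abelian_monoid.zero_closed[OF am])
  have smult: "a \<odot>\<^bsub>?D\<^esub> f \<in> carrier ?D" if "a \<in> carrier R" "f \<in> carrier ?D" for a f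
    unfolding direct_sum_module_simps(4)
    by (rule carrierI[OF _ fin[OF that(2)]])
      (auto simp: mem that module.smult_closed[OF M] module.smult_r_null[OF M])
  show ?thesis
  proof (rule moduleI)
    show "abelian_group ?D"
    proof (rule abelian_groupI)
      fix f assume f: "f \<in> carrier ?D"
      have "(\<lambda>i\<in>I. \<ominus>\<^bsub>M i\<^esub> f i) \<in> carrier ?D"
        by (rule carrierI[OF _ fin[OF f]])
          (auto simp: mem f abelian_group.a_inv_closed[OF ag] neg0)
      moreover have "(\<lambda>i\<in>I. \<ominus>\<^bsub>M i\<^esub> f i) \<oplus>\<^bsub>?D\<^esub> f = \<zero>\<^bsub>?D\<^esub>"
        unfolding direct_sum_module_simps(2,3)
        by (rule eqI) (auto simp: mem f abelian_group.l_neg[OF ag])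
      ultimately show "\<exists>g\<in>carrier ?D. g \<oplus>\<^bsub>?D\<^esub> f = \<zero>\<^bsub>?D\<^esub>" by blast
    next
      fix f g h assume "f \<in> carrier ?D" "g \<in> carrier ?D" "h \<in> carrier ?D"
      then show "f \<oplus>\<^bsub>?D\<^esub> g \<oplus>\<^bsub>?D\<^esub> h = f \<oplus>\<^bsub>?D\<^esub> (g \<oplus>\<^bsub>?D\<^esub> h)"
        unfolding direct_sum_module_simps(3)
        by (intro eqI) (auto simp: mem abelian_monoid.a_assoc[OF am])
    next
      fix f g assume "f \<in> carrier ?D" "g \<in> carrier ?D"
      then show "f \<oplus>\<^bsub>?D\<^esub> g = g \<oplus>\<^bsub>?D\<^esub> f"
        unfolding direct_sum_module_simps(3)
        by (intro eqI) (auto simp: mem abelian_monoid.a_comm[OF am])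
    next
      fix f assume "f \<in> carrier ?D"
      then show "\<zero>\<^bsub>?D\<^esub> \<oplus>\<^bsub>?D\<^esub> f = f"
        unfolding direct_sum_module_simps(2,3)
        by (intro eqI) (auto simp: mem ext abelian_monoid.l_zero[OF am])
    qed (auto simp: add zero)
  next
    fix a b f assume "a \<in> carrier R" "b \<in> carrier R" "f \<in> carrier ?D"
    then show "(a \<oplus>\<^bsub>R\<^esub> b) \<odot>\<^bsub>?D\<^esub> f = (a \<odot>\<^bsub>?D\<^esub> f) \<oplus>\<^bsub>?D\<^esub> (b \<odot>\<^bsub>?D\<^esub> f)"
      unfolding direct_sum_module_simps(3,4)
      by (intro eqI) (auto simp: mem module.smult_l_distr[OF M])
  next
    fix a f g assume "a \<in> carrier R" "f \<in> carrier ?D" "g \<in> carrier ?D"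
    then show "a \<odot>\<^bsub>?D\<^esub> (f \<oplus>\<^bsub>?D\<^esub> g) = (a \<odot>\<^bsub>?D\<^esub> f) \<oplus>\<^bsub>?D\<^esub> (a \<odot>\<^bsub>?D\<^esub> g)"
      unfolding direct_sum_module_simps(3,4)
      by (intro eqI) (auto simp: mem module.smult_r_distr[OF M])
  next
    fix a b f assume "a \<in> carrier R" "b \<in> carrier R" "f \<in> carrier ?D"
    then show "(a \<otimes>\<^bsub>R\<^esub> b) \<odot>\<^bsub>?D\<^esub> f = a \<odot>\<^bsub>?D\<^esub> (b \<odot>\<^bsub>?D\<^esub> f)"
      unfolding direct_sum_module_simps(3,4)
      by (intro eqI) (auto simp: mem module.smult_assoc1[OF M])
  next
    fix f assume "f \<in> carrier ?D"
    then show "\<one>\<^bsub>R\<^esub> \<odot>\<^bsub>?D\<^esub> f = f"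
      unfolding direct_sum_module_simps(3,4)
      by (intro eqI) (auto simp: mem ext module.smult_one[OF M])
  qed (auto simp: smult is_cring)
qed

lemma free_module_simps:
  "f \<in> carrier (free_module R B) \<longleftrightarrow> f \<in> (B \<rightarrow>\<^sub>E carrier R) \<and> finite {b \<in> B. f b \<noteq> \<zero>\<^bsub>R\<^esub>}"
  "\<zero>\<^bsub>free_module R B\<^esub> = (\<lambda>b\<in>B. \<zero>\<^bsub>R\<^esub>)"
  "f \<oplus>\<^bsub>free_module R B\<^esub> g = (\<lambda>b\<in>B. f b \<oplus>\<^bsub>R\<^esub> g b)"
  "a \<odot>\<^bsub>free_module R B\<^esub> f = (\<lambda>b\<in>B. a \<otimes>\<^bsub>R\<^esub> f b)"
  by (simp_all add: free_module_def direct_sum_module_simps)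

lemma (in cring) module_free: "module R (free_module R B)"
  unfolding free_module_def by (intro module_direct_sum is_cring module_regular)

lemma (in cring) basis_vector_closed [simp]: "basis_vector R B b \<in> carrier (free_module R B)"
proof -
  have "finite {c \<in> B. basis_vector R B b c \<noteq> \<zero>}"
    by (rule finite_subset[of _ "{b}"]) (auto simp: basis_vector_def)
  then show ?thesis
    by (auto simp: free_module_simps basis_vector_def)
qed

text \<open>A vector is the sum of its coordinates times basis vectors. Recording that the
  coordinates lie in \<open>J\<close> is what later shows that the image of a vector with
  coordinates in an ideal \<open>J\<close> lies in any submodule containing \<open>J S\<close>; with
  \<open>J\<close> equal to \<open>UNIV\<close> this is plain linear induction.\<close>

lemma (in cring) free_module_induct:
  assumes v: "v \<in> carrier (free_module R B)" "\<And>b. b \<in> B \<Longrightarrow> v b \<in> J"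
    and zero: "P \<zero>\<^bsub>free_module R B\<^esub>"
    and add: "\<And>u w. \<lbrakk>u \<in> carrier (free_module R B); w \<in> carrier (free_module R B); P u; P w\<rbrakk>
      \<Longrightarrow> P (u \<oplus>\<^bsub>free_module R B\<^esub> w)"
    and basis: "\<And>a b. \<lbrakk>a \<in> carrier R; a \<in> J; b \<in> B\<rbrakk>
      \<Longrightarrow> P (a \<odot>\<^bsub>free_module R B\<^esub> basis_vector R B b)"
  shows "P v"
proof -
  define S where "S = {b \<in> B. v b \<noteq> \<zero>}"
  have fin: "finite S" using v by (simp add: S_def free_module_simps)
  have vc: "v b \<in> carrier R" if "b \<in> B" for b
    using v that by (auto simp: free_module_simps)
  \<comment> \<open>\<open>cut T\<close> truncates \<open>v\<close> to \<open>T\<close>; the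
    induction adds the points of the support of \<open>v\<close> one by one.\<close>
  define cut where "cut T = (\<lambda>b\<in>B. if b \<in> T then v b else \<zero>)" for T
  have cut: "cut T \<in> carrier (free_module R B)" if "finite T" for T
  proof -
    have "{b \<in> B. cut T b \<noteq> \<zero>} \<subseteq> T" by (auto simp: cut_def)
    then show ?thesis
      using vc finite_subset[OF _ that] by (auto simp: cut_def free_module_simps)
  qed
  have "P (cut T)" if "finite T" "T \<subseteq> S" for T
    using that
  proof (induction T)
    case empty
    then show ?case using zero by (simp add: cut_def free_module_simps restrict_def)
  next
    case (insert b T)
    then have b: "b \<in> B" by (auto simp: S_def)
    have "cut (insert b T) = v b \<odot>\<^bsub>free_module R B\<^esub> basis_vector R B b \<oplus>\<^bsub>free_module R B\<^esub> cut T"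
      using insert.hyps vc b by (auto simp: cut_def free_module_simps basis_vector_def fun_eq_iff)
    moreover have "v b \<odot>\<^bsub>free_module R B\<^esub> basis_vector R B b \<in> carrier (free_module R B)"
      using vc[OF b] by (intro module.smult_closed[OF module_free] basis_vector_closed)
    ultimately show ?case
      using add basis[OF vc[OF b] v(2)[OF b] b] insert cut by auto
  qed
  then have "P (cut S)" using fin by blast
  moreover have "cut S = v"
    using v by (auto simp: cut_def S_def free_module_simps fun_eq_iff PiE_def extensional_def)
  ultimately show ?thesis by simp
qed

lemma (in module) free_module_lift:
  assumes h: "h \<in> B \<rightarrow> carrier M"
  obtains f where "f \<in> mod_hom R (free_module R B) M"
    and "\<And>b. b \<in> B \<Longrightarrow> f (basis_vector R B b) = h b"
proof
  let ?F = "free_module R B"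
  define f where "f v = (\<Oplus>\<^bsub>M\<^esub>b\<in>{b \<in> B. v b \<noteq> \<zero>}. v b \<odot>\<^bsub>M\<^esub> h b)" for v
  \<comment> \<open>The sum defining \<open>f v\<close> runs over the support of \<open>v\<close>,
    which changes under addition. Enlarging it to any finite \<open>T\<close> lets \<open>v\<close>,
    \<open>w\<close> and their sum be compared over one index set.\<close>
  have f_eq: "f v = (\<Oplus>\<^bsub>M\<^esub>b\<in>T. v b \<odot>\<^bsub>M\<^esub> h b)"
    if "v \<in> carrier ?F" "finite T" "{b \<in> B. v b \<noteq> \<zero>} \<subseteq> T" "T \<subseteq> B" for v T
    unfolding f_def
    by (rule M.add.finprod_mono_neutral_cong_left[OF that(2,3)])
      (use that h in \<open>auto simp: free_module_simps Pi_iff PiE_iff subset_iff\<close>)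
  interpret F: module R ?F by (rule module_free)
  show "f (basis_vector R B b) = h b" if "b \<in> B" for b
  proof -
    have *: "{c \<in> B. basis_vector R B b c \<noteq> \<zero>} \<subseteq> {b}" by (auto simp: basis_vector_def)
    have "h b \<in> carrier M" using that h by blast
    moreover have "basis_vector R B b b = \<one>" using that by (simp add: basis_vector_def)
    ultimately show ?thesis
      using that f_eq[OF basis_vector_closed _ *] by simp
  qed
  show "f \<in> mod_hom R ?F M"
    unfolding mod_hom_def
  proof (intro CollectI conjI ballI funcsetI)
    fix v assume v: "v \<in> carrier ?F"
    show "f v \<in> carrier M"
      unfolding f_def using v h by (intro M.finsum_closed) (auto simp: free_module_simps Pi_iff)
    fix w assume w: "w \<in> carrier ?F"
    define T where "T = {b \<in> B. v b \<noteq> \<zero>} \<union> {b \<in> B. w b \<noteq> \<zero>}"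
    have T: "finite T" "T \<subseteq> B" using v w by (auto simp: T_def free_module_simps)
    have vw: "v \<oplus>\<^bsub>?F\<^esub> w \<in> carrier ?F" using v w by simp
    have "f (v \<oplus>\<^bsub>?F\<^esub> w) = (\<Oplus>\<^bsub>M\<^esub>b\<in>T. (v \<oplus>\<^bsub>?F\<^esub> w) b \<odot>\<^bsub>M\<^esub> h b)"
      by (rule f_eq[OF vw T(1) _ T(2)]) (auto simp: free_module_simps T_def)
    also have "\<dots> = (\<Oplus>\<^bsub>M\<^esub>b\<in>T. v b \<odot>\<^bsub>M\<^esub> h b \<oplus>\<^bsub>M\<^esub> w b \<odot>\<^bsub>M\<^esub> h b)"
      using T v w h
      by (intro M.finsum_cong') (auto simp: free_module_simps smult_l_distr Pi_iff PiE_iff subset_iff)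
    also have "\<dots> = (\<Oplus>\<^bsub>M\<^esub>b\<in>T. v b \<odot>\<^bsub>M\<^esub> h b) \<oplus>\<^bsub>M\<^esub> (\<Oplus>\<^bsub>M\<^esub>b\<in>T. w b \<odot>\<^bsub>M\<^esub> h b)"
      using T v w h by (intro M.finsum_addf) (auto simp: free_module_simps Pi_iff PiE_iff subset_iff)
    also have "\<dots> = f v \<oplus>\<^bsub>M\<^esub> f w"
      using f_eq[OF v T(1) _ T(2)] f_eq[OF w T(1) _ T(2)] by (auto simp: T_def)
    finally show "f (v \<oplus>\<^bsub>?F\<^esub> w) = f v \<oplus>\<^bsub>M\<^esub> f w" .
  next
    fix a v assume a: "a \<in> carrier R" and v: "v \<in> carrier ?F"
    define T where "T = {b \<in> B. v b \<noteq> \<zero>}"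
    have T: "finite T" "T \<subseteq> B" using v by (auto simp: T_def free_module_simps)
    have av: "a \<odot>\<^bsub>?F\<^esub> v \<in> carrier ?F" using v a by simp
    have "f (a \<odot>\<^bsub>?F\<^esub> v) = (\<Oplus>\<^bsub>M\<^esub>b\<in>T. (a \<odot>\<^bsub>?F\<^esub> v) b \<odot>\<^bsub>M\<^esub> h b)"
      by (rule f_eq[OF av T(1) _ T(2)]) (auto simp: free_module_simps T_def a)
    also have "\<dots> = (\<Oplus>\<^bsub>M\<^esub>b\<in>T. a \<odot>\<^bsub>M\<^esub> (v b \<odot>\<^bsub>M\<^esub> h b))"
      using T v a h
      by (intro M.finsum_cong') (auto simp: free_module_simps smult_assoc1 Pi_iff PiE_iff subset_iff)
    also have "\<dots> = a \<odot>\<^bsub>M\<^esub> (\<Oplus>\<^bsub>M\<^esub>b\<in>T. v b \<odot>\<^bsub>M\<^esub> h b)"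
      using T v a h
      by (intro finsum_smult_ldistr[symmetric]) (auto simp: free_module_simps Pi_iff PiE_iff subset_iff)
    also have "\<dots> = a \<odot>\<^bsub>M\<^esub> f v" by (simp add: f_def T_def)
    finally show "f (a \<odot>\<^bsub>?F\<^esub> v) = a \<odot>\<^bsub>M\<^esub> f v" .
  qed
qed

section \<open>Ideals and Nakayama's lemma\<close>

lemma (in cring) idealI_cring:
  assumes "J \<subseteq> carrier R" "\<zero> \<in> J" "\<And>a b. a \<in> J \<Longrightarrow> b \<in> J \<Longrightarrow> a \<oplus> b \<in> J"
    "\<And>a r. a \<in> J \<Longrightarrow> r \<in> carrier R \<Longrightarrow> r \<otimes> a \<in> J"
  shows "ideal J R"
proof (rule idealI[OF ring_axioms])
  show "subgroup J (add_monoid R)"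
  proof (rule group.subgroupI[OF a_group])
    show "inv\<^bsub>add_monoid R\<^esub> a \<in> J" if "a \<in> J" for a
      using assms(4)[OF that, of "\<ominus> \<one>"] that assms(1)
      by (auto simp: a_inv_def[symmetric] l_minus subset_iff)
  qed (use assms in auto)
qed (use assms in \<open>auto simp: m_comm subset_iff\<close>)

lemma (in module) smult_mod_hom:
  assumes "a \<in> carrier R"
  shows "(\<lambda>x. a \<odot>\<^bsub>M\<^esub> x) \<in> mod_hom R M M"
  using assms by (auto simp: mod_hom_def smult_r_distr m_comm simp flip: smult_assoc1)

text \<open>This submodule is \<open>J a + N\<close>. With \<open>J\<close> the whole ring it bounds
  the span of \<open>N\<close> and one more generator \<open>a\<close>; with the given ideal it
  receives the elements \<open>(1 - r) j m\<close> in the induction for Nakayama's lemma.\<close>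

lemma (in module) submodule_ideal_smult_add:
  assumes "ideal J R" "a \<in> carrier M" "submodule N R M"
  shows "submodule {b \<odot>\<^bsub>M\<^esub> a \<oplus>\<^bsub>M\<^esub> n |b n. b \<in> J \<and> n \<in> N} R M" (is "submodule ?Q R M")
proof -
  interpret J: ideal J R by fact
  note N = submoduleE[OF assms(3)]
  have Q: "x \<in> ?Q" if "b \<in> J" "n \<in> N" "x = b \<odot>\<^bsub>M\<^esub> a \<oplus>\<^bsub>M\<^esub> n" for x b n
    using that by blast
  show ?thesis
  proof (rule submoduleI)
    show "?Q \<subseteq> carrier M" using N(1) J.a_subset assms(2) by auto
    show "\<zero>\<^bsub>M\<^esub> \<in> ?Q"
      by (rule Q[OF J.zero_closed submodule_zero[OF assms(3)]]) (simp add: assms(2))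
    fix x assume "x \<in> ?Q"
    then obtain b n where x: "b \<in> J" "n \<in> N" "x = b \<odot>\<^bsub>M\<^esub> a \<oplus>\<^bsub>M\<^esub> n" by blast
    then have c: "b \<in> carrier R" "n \<in> carrier M" using N(1) J.a_subset by auto
    show "\<ominus>\<^bsub>M\<^esub> x \<in> ?Q"
      by (rule Q[of "\<ominus> b" "\<ominus>\<^bsub>M\<^esub> n"])
        (use x c N(3) assms(2) in \<open>auto simp: M.minus_add smult_l_minus\<close>)
    show "r \<odot>\<^bsub>M\<^esub> x \<in> ?Q" if r: "r \<in> carrier R" for r
      by (rule Q[of "r \<otimes> b" "r \<odot>\<^bsub>M\<^esub> n"])
        (use x c N(4) r assms(2) J.I_l_closed in \<open>auto simp: smult_r_distr smult_assoc1\<close>)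
    fix y assume "y \<in> ?Q"
    then obtain b' n' where y: "b' \<in> J" "n' \<in> N" "y = b' \<odot>\<^bsub>M\<^esub> a \<oplus>\<^bsub>M\<^esub> n'" by blast
    then have c': "b' \<in> carrier R" "n' \<in> carrier M" using N(1) J.a_subset by auto
    show "x \<oplus>\<^bsub>M\<^esub> y \<in> ?Q"
      by (rule Q[of "b \<oplus> b'" "n \<oplus>\<^bsub>M\<^esub> n'"])
        (use x c y c' N(5) assms(2) in \<open>auto simp: smult_l_distr M.a_ac\<close>)
  qed
qed

text \<open>One generator \<open>a\<close> of \<open>A\<close> is removed at a time: \<open>JM = M\<close> gives \<open>(1 - r) a = b a + n\<close> with \<open>b \<in> J\<close> and
  \<open>n\<close> in the span of the other generators, so \<open>(1 - r - b) a\<close> lies in that span.\<close>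

lemma (in module) nakayama_aux:
  assumes "finite A" "A \<subseteq> carrier M" and J: "ideal J R"
    and JM: "\<And>H. submodule H R M \<Longrightarrow> (\<And>j m. j \<in> J \<Longrightarrow> m \<in> carrier M \<Longrightarrow> j \<odot>\<^bsub>M\<^esub> m \<in> H)
      \<Longrightarrow> carrier M \<subseteq> H"
    and "r \<in> J" "\<And>m. m \<in> carrier M \<Longrightarrow> (\<one> \<ominus> r) \<odot>\<^bsub>M\<^esub> m \<in> module_span R M A"
  shows "\<exists>r\<in>J. \<forall>m\<in>carrier M. (\<one> \<ominus> r) \<odot>\<^bsub>M\<^esub> m = \<zero>\<^bsub>M\<^esub>"
  using assms(1,2,5,6)
proof (induction A arbitrary: r)
  case empty
  have "submodule {\<zero>\<^bsub>M\<^esub>} R M" by (rule submoduleI) auto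
  from module_span_minimal[OF this] empty show ?case by blast
next
  case (insert a A)
  interpret J: ideal J R by fact
  let ?N = "module_span R M A"
  have a: "a \<in> carrier M" and A: "A \<subseteq> carrier M" using insert.prems by auto
  have N: "submodule ?N R M" by (rule module_span_submodule[OF module_axioms A])
  note NE = submoduleE[OF N]
  have r: "r \<in> carrier R" using insert.prems J.a_subset by auto
  have "submodule {b \<odot>\<^bsub>M\<^esub> a \<oplus>\<^bsub>M\<^esub> n |b n. b \<in> carrier R \<and> n \<in> ?N} R M"
    by (rule submodule_ideal_smult_add[OF oneideal a N])
  moreover have "insert a A \<subseteq> {b \<odot>\<^bsub>M\<^esub> a \<oplus>\<^bsub>M\<^esub> n |b n. b \<in> carrier R \<and> n \<in> ?N}" (is "_ \<subseteq> ?Q")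
  proof -
    have "a = \<one> \<odot>\<^bsub>M\<^esub> a \<oplus>\<^bsub>M\<^esub> \<zero>\<^bsub>M\<^esub>" using a by simp
    moreover have "x = \<zero> \<odot>\<^bsub>M\<^esub> a \<oplus>\<^bsub>M\<^esub> x" if "x \<in> A" for x using a A that by auto
    ultimately show ?thesis
      using submodule_zero[OF N] module_span_superset[of A R M]
      by (auto intro: exI[of _ \<one>] exI[of _ \<zero>])
  qed
  ultimately have span: "module_span R M (insert a A) \<subseteq> ?Q"
    by (rule module_span_minimal)
  have rm: "\<exists>b\<in>carrier R. \<exists>n\<in>?N. (\<one> \<ominus> r) \<odot>\<^bsub>M\<^esub> m = b \<odot>\<^bsub>M\<^esub> a \<oplus>\<^bsub>M\<^esub> n" if "m \<in> carrier M" for m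
    using insert.prems(3)[OF that] span by blast
  have r1: "\<one> \<ominus> r \<in> carrier R" using r by simp
  \<comment> \<open>The elements \<open>m\<close> with \<open>(1 - r) m\<close> in
    \<open>J a + N\<close> form a submodule containing all products \<open>j m\<close>, so by
    \<open>JM\<close> it is everything; the case \<open>m = a\<close> is then used.\<close>
  have "carrier M \<subseteq> {m \<in> carrier M. (\<one> \<ominus> r) \<odot>\<^bsub>M\<^esub> m
      \<in> {b \<odot>\<^bsub>M\<^esub> a \<oplus>\<^bsub>M\<^esub> n |b n. b \<in> J \<and> n \<in> ?N}}"
  proof (rule JM)
    show "submodule {m \<in> carrier M. (\<one> \<ominus> r) \<odot>\<^bsub>M\<^esub> m
        \<in> {b \<odot>\<^bsub>M\<^esub> a \<oplus>\<^bsub>M\<^esub> n |b n. b \<in> J \<and> n \<in> ?N}} R M"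
      by (rule mod_hom_vimage_submodule[OF module_axioms module_axioms smult_mod_hom[OF r1]
            submodule_ideal_smult_add[OF J a N]])
  next
    fix j m assume j: "j \<in> J" and m: "m \<in> carrier M"
    then have jc: "j \<in> carrier R" using J.a_subset by auto
    obtain b n where bn: "b \<in> carrier R" "n \<in> ?N" "(\<one> \<ominus> r) \<odot>\<^bsub>M\<^esub> m = b \<odot>\<^bsub>M\<^esub> a \<oplus>\<^bsub>M\<^esub> n"
      using rm[OF m] by blast
    have n: "n \<in> carrier M" using bn NE(1) by auto
    have "(\<one> \<ominus> r) \<odot>\<^bsub>M\<^esub> (j \<odot>\<^bsub>M\<^esub> m) = j \<odot>\<^bsub>M\<^esub> ((\<one> \<ominus> r) \<odot>\<^bsub>M\<^esub> m)"
      using jc m r1 by (metis R.m_comm smult_assoc1)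
    also have "\<dots> = (j \<otimes> b) \<odot>\<^bsub>M\<^esub> a \<oplus>\<^bsub>M\<^esub> j \<odot>\<^bsub>M\<^esub> n"
      using bn jc a n by (simp add: smult_r_distr smult_assoc1)
    finally show "j \<odot>\<^bsub>M\<^esub> m \<in> {m \<in> carrier M. (\<one> \<ominus> r) \<odot>\<^bsub>M\<^esub> m
        \<in> {b \<odot>\<^bsub>M\<^esub> a \<oplus>\<^bsub>M\<^esub> n |b n. b \<in> J \<and> n \<in> ?N}}"
      using J.I_r_closed[OF j bn(1)] NE(4)[OF jc bn(2)] jc m by blast
  qed
  with a obtain b n where b: "b \<in> J" and n: "n \<in> ?N"
    and eq: "(\<one> \<ominus> r) \<odot>\<^bsub>M\<^esub> a = b \<odot>\<^bsub>M\<^esub> a \<oplus>\<^bsub>M\<^esub> n" by blast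
  have bc: "b \<in> carrier R" and nc: "n \<in> carrier M" using b n J.a_subset NE(1) by auto
  define s where "s = r \<oplus> b"
  have s: "s \<in> J" "s \<in> carrier R" using insert.prems b bc r by (auto simp: s_def)
  have "(\<one> \<ominus> s) \<odot>\<^bsub>M\<^esub> a = (\<one> \<ominus> r) \<odot>\<^bsub>M\<^esub> a \<ominus>\<^bsub>M\<^esub> b \<odot>\<^bsub>M\<^esub> a"
  proof -
    have "\<one> \<ominus> s = (\<one> \<ominus> r) \<oplus> (\<ominus> b)"
      unfolding s_def using r bc by algebra
    then show ?thesis using r1 bc a by (simp add: smult_l_distr smult_l_minus a_minus_def[of M])
  qed
  also have "\<dots> = n"
    using eq bc a nc by (simp add: a_minus_def M.a_ac M.r_neg)
  finally have sa: "(\<one> \<ominus> s) \<odot>\<^bsub>M\<^esub> a \<in> ?N" using n by simp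
  \<comment> \<open>This element is chosen so that one minus it is \<open>(1 - s) (1 - r)\<close>:
    the factor \<open>1 - r\<close> moves \<open>M\<close> into the span of
    \<open>insert a A\<close>, and \<open>1 - s\<close> then moves \<open>a\<close> into the span of
    \<open>A\<close>.\<close>
  have r': "s \<oplus> r \<ominus> s \<otimes> r \<in> J"
    using s insert.prems(2) r J.I_r_closed by (auto simp: a_minus_def)
  show ?case
  proof (rule insert.IH[OF A r'])
    fix m assume m: "m \<in> carrier M"
    obtain b n where bn: "b \<in> carrier R" "n \<in> ?N" "(\<one> \<ominus> r) \<odot>\<^bsub>M\<^esub> m = b \<odot>\<^bsub>M\<^esub> a \<oplus>\<^bsub>M\<^esub> n"
      using rm[OF m] by blast
    have n: "n \<in> carrier M" using bn NE(1) by auto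
    have s1: "\<one> \<ominus> s \<in> carrier R" using s by simp
    have "\<one> \<ominus> (s \<oplus> r \<ominus> s \<otimes> r) = (\<one> \<ominus> s) \<otimes> (\<one> \<ominus> r)"
      using s(2) r by algebra
    then have "(\<one> \<ominus> (s \<oplus> r \<ominus> s \<otimes> r)) \<odot>\<^bsub>M\<^esub> m = (\<one> \<ominus> s) \<odot>\<^bsub>M\<^esub> ((\<one> \<ominus> r) \<odot>\<^bsub>M\<^esub> m)"
      using s1 r1 m by (simp add: smult_assoc1)
    also have "\<dots> = (\<one> \<ominus> s) \<odot>\<^bsub>M\<^esub> (b \<odot>\<^bsub>M\<^esub> a) \<oplus>\<^bsub>M\<^esub> (\<one> \<ominus> s) \<odot>\<^bsub>M\<^esub> n"
      using bn a n s1 by (simp add: smult_r_distr)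
    also have "(\<one> \<ominus> s) \<odot>\<^bsub>M\<^esub> (b \<odot>\<^bsub>M\<^esub> a) = b \<odot>\<^bsub>M\<^esub> ((\<one> \<ominus> s) \<odot>\<^bsub>M\<^esub> a)"
      using bn a s1 by (metis R.m_comm smult_assoc1)
    finally show "(\<one> \<ominus> (s \<oplus> r \<ominus> s \<otimes> r)) \<odot>\<^bsub>M\<^esub> m \<in> ?N"
      using NE(4)[OF bn(1) sa] NE(4)[OF s1 bn(2)] NE(5) by simp
  qed
qed

text \<open>The hypothesis \<open>JM\<close> expresses \<open>J M = M\<close> without forming the
  product: every submodule that contains all \<open>j m\<close> is \<open>M\<close>. The induction
  starts from a finite generating set with \<open>r = 0\<close>.\<close>

lemma (in module) nakayama:
  assumes fg: "finitely_generated_module R M" and J: "ideal J R"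
    and JM: "\<And>H. submodule H R M \<Longrightarrow> (\<And>j m. j \<in> J \<Longrightarrow> m \<in> carrier M \<Longrightarrow> j \<odot>\<^bsub>M\<^esub> m \<in> H)
      \<Longrightarrow> carrier M \<subseteq> H"
  shows "\<exists>r\<in>J. \<forall>m\<in>carrier M. (\<one> \<ominus> r) \<odot>\<^bsub>M\<^esub> m = \<zero>\<^bsub>M\<^esub>"
proof -
  obtain A where "finite A" "A \<subseteq> carrier M" "module_span R M A = carrier M"
    using fg by (auto simp: finitely_generated_module_def)
  moreover have "\<zero> \<in> J"
    using J by (simp add: additive_subgroup.zero_closed ideal.axioms(1))
  ultimately show ?thesis
    by (intro nakayama_aux[OF _ _ J JM]) auto
qed


section \<open>Actions of finite p-groups\<close>

lemma prime_power_dvd_cases: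
  fixes p :: nat
  assumes "Factorial_Ring.prime p" "m dvd p ^ n"
  shows "m = 1 \<or> p dvd m"
proof -
  obtain i where "m = p ^ i" using assms by (auto simp: divides_primepow_nat)
  then show ?thesis by (cases i) auto
qed

text \<open>The inverse of the map given by \<open>g\<close> is the map given by the inverse of
  \<open>g\<close>. The restriction to \<open>E\<close> is there because \<open>BijGroup E\<close>
  consists of bijections that are extensional on \<open>E\<close>.\<close>

lemma (in group) group_actionI:
  assumes closed: "\<And>g x. \<lbrakk>g \<in> carrier G; x \<in> E\<rbrakk> \<Longrightarrow> \<psi> g x \<in> E"
    and one: "\<And>x. x \<in> E \<Longrightarrow> \<psi> \<one> x = x"
    and comp: "\<And>g h x. \<lbrakk>g \<in> carrier G; h \<in> carrier G; x \<in> E\<rbrakk> \<Longrightarrow> \<psi> (g \<otimes> h) x = \<psi> g (\<psi> h x)"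
  shows "group_action G E (\<lambda>g. \<lambda>x\<in>E. \<psi> g x)"
proof -
  have bij: "(\<lambda>x\<in>E. \<psi> g x) \<in> Bij E" if g: "g \<in> carrier G" for g
  proof -
    have "bij_betw (\<psi> g) E E"
      by (rule bij_betwI[where g = "\<psi> (inv g)"])
        (use g closed one in \<open>auto simp flip: comp\<close>)
    then show ?thesis by (simp add: Bij_def)
  qed
  have "(\<lambda>g. \<lambda>x\<in>E. \<psi> g x) \<in> hom G (BijGroup E)"
    using bij closed comp by (auto simp: hom_def BijGroup_def compose_def fun_eq_iff)
  then show ?thesis
    by (intro group_action.intro group_hom.intro group_hom_axioms.intro group_BijGroup is_group)
qed

text \<open>Class equation: an orbit has size dividing \<open>p ^ n\<close>, so it is a single point
  or has size divisible by \<open>p\<close>. Were \<open>x\<close> the only fixed point,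
  \<open>card E\<close> would be 1 modulo \<open>p\<close>.\<close>

lemma (in group_action) p_group_fixed_point:
  assumes p: "Factorial_Ring.prime p" and G: "order G = p ^ n"
    and E: "finite E" "p dvd card E" and x: "x \<in> E" "\<And>g. g \<in> carrier G \<Longrightarrow> \<phi> g x = x"
  shows "\<exists>y\<in>E. y \<noteq> x \<and> (\<forall>g\<in>carrier G. \<phi> g y = y)"
proof (rule ccontr)
  assume contra: "\<not> ?thesis"
  have orb_x: "orbit G \<phi> x = {x}"
    using x orbit_refl[OF x(1)] by (auto simp: orbit_def)
  have x_orb: "{x} \<in> orbits G E \<phi>" using orb_x x(1) by (auto simp: orbits_def)
  have fin: "finite (orbits G E \<phi>)" using E(1) by (simp add: orbits_def)
  have "p dvd card B" if B: "B \<in> orbits G E \<phi> - {{x}}" for B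
  proof -
    obtain y where y: "y \<in> E" "B = orbit G \<phi> y" using B by (auto simp: orbits_def)
    have "card B \<noteq> 1"
    proof
      assume "card B = 1"
      then have "B = {y}" using orbit_refl[OF y(1)] y(2) by (auto simp: card_1_singleton_iff)
      then have "\<forall>g\<in>carrier G. \<phi> g y = y" using y(2) by (auto simp: orbit_def)
      with contra y(1) have "y = x" by blast
      with \<open>B = {y}\<close> B show False by simp
    qed
    moreover have "card B dvd p ^ n"
      using orbit_stabilizer_theorem[OF y(1)] y(2) G by (metis dvd_triv_left)
    ultimately show ?thesis using prime_power_dvd_cases[OF p] by blast
  qed
  then have "p dvd (\<Sum>B\<in>orbits G E \<phi> - {{x}}. card B)" by (rule dvd_sum)
  moreover have "card E = (\<Sum>B\<in>orbits G E \<phi>. card B)"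
    using disjoint_sum[OF E(1), of "\<lambda>_. 1 :: nat"] by (simp only: card_eq_sum)
  then have "card E = 1 + (\<Sum>B\<in>orbits G E \<phi> - {{x}}. card B)"
    using sum.remove[OF fin x_orb, of card] by simp
  ultimately have "p dvd 1" using E(2) by (metis dvd_add_left_iff)
  then show False using p by auto
qed

text \<open>\<open>G\<close> permutes the cosets of \<open>W\<close>, because it acts by
  automorphisms preserving \<open>W\<close>. Their number is a power of \<open>p\<close> other than
  1, and \<open>W\<close> is a fixed coset, so there is a second fixed coset \<open>W v\<close>; the
  conclusion spells out that \<open>v\<close> and its image lie in the same coset.\<close>

lemma p_group_fixed_coset:
  assumes p: "Factorial_Ring.prime p" and G: "group G" "order G = p ^ n"
    and V: "group V" "order V = p ^ k"
    and W: "subgroup W V" "W \<noteq> carrier V"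
    and closed: "\<And>g v. \<lbrakk>g \<in> carrier G; v \<in> carrier V\<rbrakk> \<Longrightarrow> \<psi> g v \<in> carrier V"
    and one: "\<And>v. v \<in> carrier V \<Longrightarrow> \<psi> \<one>\<^bsub>G\<^esub> v = v"
    and comp: "\<And>g h v. \<lbrakk>g \<in> carrier G; h \<in> carrier G; v \<in> carrier V\<rbrakk>
      \<Longrightarrow> \<psi> (g \<otimes>\<^bsub>G\<^esub> h) v = \<psi> g (\<psi> h v)"
    and hom: "\<And>g v w. \<lbrakk>g \<in> carrier G; v \<in> carrier V; w \<in> carrier V\<rbrakk>
      \<Longrightarrow> \<psi> g (v \<otimes>\<^bsub>V\<^esub> w) = \<psi> g v \<otimes>\<^bsub>V\<^esub> \<psi> g w"
    and stable: "\<And>g w. \<lbrakk>g \<in> carrier G; w \<in> W\<rbrakk> \<Longrightarrow> \<psi> g w \<in> W"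
  shows "\<exists>v\<in>carrier V - W. \<forall>g\<in>carrier G. \<psi> g v \<otimes>\<^bsub>V\<^esub> inv\<^bsub>V\<^esub> v \<in> W"
proof -
  interpret G: group G by fact
  interpret V: group V by fact
  interpret W: subgroup W V by fact
  define E where "E = rcosets\<^bsub>V\<^esub> W"
  have finV: "finite (carrier V)"
    using V(2) p by (metis V.order_gt_0_iff_finite prime_gt_0_nat zero_less_power)
  have finE: "finite E" unfolding E_def RCOSETS_def using finV by simp
  have img: "\<psi> g ` (W #>\<^bsub>V\<^esub> v) = W #>\<^bsub>V\<^esub> \<psi> g v" if g: "g \<in> carrier G" and v: "v \<in> carrier V" for g v
  proof
    show "\<psi> g ` (W #>\<^bsub>V\<^esub> v) \<subseteq> W #>\<^bsub>V\<^esub> \<psi> g v"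
      using hom[OF g] stable[OF g] v W.mem_carrier by (fastforce simp: r_coset_def)
    show "W #>\<^bsub>V\<^esub> \<psi> g v \<subseteq> \<psi> g ` (W #>\<^bsub>V\<^esub> v)"
    proof
      fix x assume "x \<in> W #>\<^bsub>V\<^esub> \<psi> g v"
      then obtain w where w: "w \<in> W" "x = w \<otimes>\<^bsub>V\<^esub> \<psi> g v" by (auto simp: r_coset_def)
      \<comment> \<open>Stability under the inverse of \<open>g\<close> makes \<open>W\<close> equal
        to its image under \<open>g\<close>, not merely contain it.\<close>
      let ?w = "\<psi> (inv\<^bsub>G\<^esub> g) w"
      have "?w \<in> W" using g w stable by simp
      moreover have "\<psi> g ?w = w"
        using g w one comp[of g "inv\<^bsub>G\<^esub> g" w] by simp
      ultimately show "x \<in> \<psi> g ` (W #>\<^bsub>V\<^esub> v)"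
        using hom[OF g, of ?w v] v w by (force simp: r_coset_def)
    qed
  qed
  have W_coset: "W = W #>\<^bsub>V\<^esub> \<one>\<^bsub>V\<^esub>" by (simp add: W.subset)
  have E: "B \<in> E \<longleftrightarrow> (\<exists>v\<in>carrier V. B = W #>\<^bsub>V\<^esub> v)" for B
    by (auto simp: E_def RCOSETS_def)
  interpret A: group_action G E "\<lambda>g. \<lambda>B\<in>E. \<psi> g ` B"
  proof (rule G.group_actionI)
    show "\<psi> g ` B \<in> E" if "g \<in> carrier G" "B \<in> E" for g B
      using that closed img unfolding E by blast
    show "\<psi> \<one>\<^bsub>G\<^esub> ` B = B" if "B \<in> E" for B
    proof -
      have "B \<subseteq> carrier V"
        using that V.rcosets_subset_PowG[OF W(1)] by (auto simp: E_def)
      then have "\<psi> \<one>\<^bsub>G\<^esub> ` B = id ` B" by (intro image_cong) (auto simp: one)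
      then show ?thesis by simp
    qed
    show "\<psi> (g \<otimes>\<^bsub>G\<^esub> h) ` B = \<psi> g ` \<psi> h ` B" if gh: "g \<in> carrier G" "h \<in> carrier G" and B: "B \<in> E" for g h B
    proof -
      obtain v where v: "v \<in> carrier V" "B = W #>\<^bsub>V\<^esub> v" using B E by blast
      then show ?thesis
        using gh by (simp add: img closed comp)
    qed
  qed
  have lagrange: "card E * card W = p ^ k"
    using V.lagrange[OF W(1)] V(2) by (simp add: E_def)
  have "card E \<noteq> 1"
  proof
    assume "card E = 1"
    then have "card W = card (carrier V)" using lagrange V(2) by (simp add: order_def)
    then show False using W(2) W.subset finV by (simp add: card_subset_eq)
  qed
  then have "p dvd card E"
    using prime_power_dvd_cases[OF p, of "card E" k] lagrange by (metis dvd_triv_left)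
  moreover have WE: "W \<in> E" using W_coset E by blast
  moreover have "\<psi> g ` W = W" if "g \<in> carrier G" for g
  proof -
    have "\<psi> g \<one>\<^bsub>V\<^esub> \<in> W" using stable that by simp
    then show ?thesis
      using img[OF that, of "\<one>\<^bsub>V\<^esub>"] W_coset V.coset_join2[OF _ W(1)] closed that by simp
  qed
  ultimately have "\<exists>B\<in>E. B \<noteq> W \<and> (\<forall>g\<in>carrier G. (\<lambda>B\<in>E. \<psi> g ` B) B = B)"
    by (intro A.p_group_fixed_point[OF p G(2) finE]) auto
  then obtain B where B: "B \<in> E" "B \<noteq> W" "\<And>g. g \<in> carrier G \<Longrightarrow> \<psi> g ` B = B"
    by (metis restrict_apply')
  then obtain v where v: "v \<in> carrier V" "B = W #>\<^bsub>V\<^esub> v" using E by blast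
  have "v \<notin> W" using B(2) v V.coset_join2[OF v(1) W(1)] by auto
  moreover have "\<psi> g v \<otimes>\<^bsub>V\<^esub> inv\<^bsub>V\<^esub> v \<in> W" if g: "g \<in> carrier G" for g
  proof -
    have "W #>\<^bsub>V\<^esub> \<psi> g v = W #>\<^bsub>V\<^esub> v" using img[OF g v(1)] B(3)[OF g] v(2) by simp
    then have "\<psi> g v \<in> W #>\<^bsub>V\<^esub> v"
      using V.rcos_self[OF closed[OF g v(1)] W(1)] by simp
    then show ?thesis
      using v(1) by (auto simp: r_coset_def V.m_assoc)
  qed
  ultimately show ?thesis using v(1) by blast
qed

text \<open>\<open>finsum\<close> depends only on carrier, zero and addition. This lets coordinate
  maps be treated as linear maps into the regular module.\<close>

lemma finsum_regular_module [simp]: "finsum (regular_module A) = finsum A"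
  by (simp add: fun_eq_iff finsum_def finprod_def)

text \<open>\<open>P\<close> is the additive group generated by 1, whose order divides
  \<open>p\<close>. Leaving the exponent open covers the zero ring, where \<open>P\<close> has one
  element.\<close>

lemma (in cring) prime_subgroup:
  assumes "Factorial_Ring.prime p" "[p] \<cdot> \<one> = \<zero>"
  obtains P j where "subgroup P (add_monoid R)" "\<one> \<in> P" "card P = p ^ j"
proof -
  let ?P = "generate (add_monoid R) {\<one>}"
  have "card ?P dvd p ^ 1"
    using assms(2) add.pow_eq_id[of \<one> p] add.generate_pow_card[of \<one>] by simp
  then obtain j where j: "card ?P = p ^ j"
    unfolding divides_primepow_nat[OF assms(1)] by blast
  then show ?thesis
    by (intro that[of ?P j] add.generate_is_subgroup generate.incl) auto
qed

text \<open>\<open>R[G]\<close> may be infinite, so orbits are counted in the finite subgroup of functions with values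
  in the prime subring.  The map \<open>\<tau>\<close> stands for left translation \<open>h \<mapsto> g\<^sup>-\<^sup>1 h\<close> or right translation
  \<open>h \<mapsto> h g\<close>.\<close>

lemma p_group_ring_fixed_coset:
  assumes "cring R" and p: "Factorial_Ring.prime p" "[p] \<cdot>\<^bsub>R\<^esub> \<one>\<^bsub>R\<^esub> = \<zero>\<^bsub>R\<^esub>"
    and G: "group G" "order G = p ^ n"
    and \<tau>: "\<And>g h. \<lbrakk>g \<in> carrier G; h \<in> carrier G\<rbrakk> \<Longrightarrow> \<tau> g h \<in> carrier G"
      "\<And>h. h \<in> carrier G \<Longrightarrow> \<tau> \<one>\<^bsub>G\<^esub> h = h"
      "\<And>g g' h. \<lbrakk>g \<in> carrier G; g' \<in> carrier G; h \<in> carrier G\<rbrakk>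
        \<Longrightarrow> \<tau> (g \<otimes>\<^bsub>G\<^esub> g') h = \<tau> g' (\<tau> g h)"
    and U: "subgroup U (add_monoid (free_module R (carrier G)))"
      "basis_vector R (carrier G) h\<^sub>0 \<notin> U"
      "\<And>g v. \<lbrakk>g \<in> carrier G; v \<in> U\<rbrakk> \<Longrightarrow> (\<lambda>h\<in>carrier G. v (\<tau> g h)) \<in> U"
  shows "\<exists>v\<in>carrier (free_module R (carrier G)) - U. \<forall>g\<in>carrier G.
    (\<lambda>h\<in>carrier G. v (\<tau> g h)) \<ominus>\<^bsub>free_module R (carrier G)\<^esub> v \<in> U"
proof -
  interpret cring R by fact
  interpret G: group G by fact
  obtain P j where P: "subgroup P (add_monoid R)" "\<one>\<^bsub>R\<^esub> \<in> P" "card P = p ^ j"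
    by (rule prime_subgroup[OF p])
  interpret P: additive_subgroup P R by (rule additive_subgroupI[OF P(1)])
  let ?F = "free_module R (carrier G)"
  interpret F: module R ?F by (rule module_free)
  have fin: "finite (carrier G)"
    using G(2) p(1) by (metis G.order_gt_0_iff_finite prime_gt_0_nat zero_less_power)
  define V where "V = (carrier G \<rightarrow>\<^sub>E P)"
  have VF: "V \<subseteq> carrier ?F"
    using fin P.a_subset by (auto simp: V_def free_module_simps PiE_iff)
  have minus: "\<ominus>\<^bsub>?F\<^esub> v = (\<lambda>g\<in>carrier G. \<ominus>\<^bsub>R\<^esub> v g)" if v: "v \<in> carrier ?F" for v
  proof (rule F.M.minus_equality)
    show "(\<lambda>g\<in>carrier G. \<ominus>\<^bsub>R\<^esub> v g) \<in> carrier ?F"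
      using v fin by (auto simp: free_module_simps PiE_iff)
    show "(\<lambda>g\<in>carrier G. \<ominus>\<^bsub>R\<^esub> v g) \<oplus>\<^bsub>?F\<^esub> v = \<zero>\<^bsub>?F\<^esub>"
      using v by (auto simp: free_module_simps PiE_iff l_neg intro!: restrict_ext)
  qed (rule v)
  have V: "subgroup V (add_monoid ?F)"
  proof (rule group.subgroupI[OF F.M.a_group])
    show "V \<noteq> {}" using P(2) by (auto simp: V_def PiE_eq_empty_iff)
    show "inv\<^bsub>add_monoid ?F\<^esub> v \<in> V" if "v \<in> V" for v
      using minus[of v] that VF by (auto simp: V_def a_inv_def[symmetric] PiE_iff subset_iff)
  qed (use VF in \<open>auto simp: V_def free_module_simps PiE_iff\<close>)
  let ?V = "(add_monoid ?F)\<lparr>carrier := V\<rparr>"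
  interpret V: group ?V by (rule subgroup.subgroup_is_group[OF V F.M.a_group])
  have orderV: "order ?V = p ^ (j * card (carrier G))"
    using fin P(3) by (simp add: order_def V_def card_PiE power_mult)
  \<comment> \<open>Since 1 belongs to \<open>P\<close>, the basis vector excluded from
    \<open>U\<close> lies in \<open>V\<close>; this makes the intersection of \<open>U\<close> and
    \<open>V\<close> proper in \<open>V\<close>.\<close>
  have one: "basis_vector R (carrier G) h\<^sub>0 \<in> V"
    using P(2) P.zero_closed by (auto simp: V_def basis_vector_def)
  have \<psi>V: "(\<lambda>h\<in>carrier G. v (\<tau> g h)) \<in> V" if "g \<in> carrier G" "v \<in> V" for g v
    using that \<tau>(1) by (auto simp: V_def PiE_iff)
  have "\<exists>v\<in>carrier ?V - (U \<inter> V). \<forall>g\<in>carrier G.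
      (\<lambda>h\<in>carrier G. v (\<tau> g h)) \<otimes>\<^bsub>?V\<^esub> inv\<^bsub>?V\<^esub> v \<in> U \<inter> V"
  proof (rule p_group_fixed_coset[OF p(1) G V.is_group orderV])
    show "subgroup (U \<inter> V) ?V"
      by (rule group.subgroup_incl[OF F.M.a_group group.subgroups_Inter_pair[OF F.M.a_group U(1) V] V]) auto
    show "U \<inter> V \<noteq> carrier ?V" using one U(2) by auto
  qed (use \<tau> U(3) \<psi>V in \<open>auto simp: V_def free_module_simps PiE_iff extensional_def fun_eq_iff\<close>)
  then obtain v where v: "v \<in> V" "v \<notin> U"
    and *: "\<And>g. g \<in> carrier G \<Longrightarrow> (\<lambda>h\<in>carrier G. v (\<tau> g h)) \<otimes>\<^bsub>?V\<^esub> inv\<^bsub>?V\<^esub> v \<in> U"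
    by auto
  have "(\<lambda>h\<in>carrier G. v (\<tau> g h)) \<ominus>\<^bsub>?F\<^esub> v \<in> U" if "g \<in> carrier G" for g
    using *[OF that] group.m_inv_consistent[OF F.M.a_group V v(1)] by (simp add: a_minus_def a_inv_def)
  then show ?thesis using v VF by blast
qed

section \<open>The group ring acting on a module\<close>

text \<open>\<open>M\<close> is only a module, so that the locale applies both to \<open>S\<close>
  with the Galois action and to \<open>R[G]\<close> itself under left translation.\<close>

locale linear_action = module R M + G: group G
  for R :: "('r, 'k) ring_scheme" (structure)
    and M :: "('r, 's, 'm) module_scheme"
    and G :: "('g, 'l) monoid_scheme" +
  fixes \<phi> :: "'g \<Rightarrow> 's \<Rightarrow> 's"
  assumes finite_G: "finite (carrier G)"
    and \<phi>_closed [simp]: "\<lbrakk>g \<in> carrier G; x \<in> carrier M\<rbrakk> \<Longrightarrow> \<phi> g x \<in> carrier M"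
    and \<phi>_one [simp]: "x \<in> carrier M \<Longrightarrow> \<phi> \<one>\<^bsub>G\<^esub> x = x"
    and \<phi>_mult: "\<lbrakk>g \<in> carrier G; h \<in> carrier G; x \<in> carrier M\<rbrakk> \<Longrightarrow> \<phi> (g \<otimes>\<^bsub>G\<^esub> h) x = \<phi> g (\<phi> h x)"
    and \<phi>_add: "\<lbrakk>g \<in> carrier G; x \<in> carrier M; y \<in> carrier M\<rbrakk>
      \<Longrightarrow> \<phi> g (x \<oplus>\<^bsub>M\<^esub> y) = \<phi> g x \<oplus>\<^bsub>M\<^esub> \<phi> g y"
    and \<phi>_smult: "\<lbrakk>g \<in> carrier G; r \<in> carrier R; x \<in> carrier M\<rbrakk>
      \<Longrightarrow> \<phi> g (r \<odot>\<^bsub>M\<^esub> x) = r \<odot>\<^bsub>M\<^esub> \<phi> g x"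
begin

text \<open>Only the \<open>R\<close>-module underlying \<open>R[G]\<close>; the convolution product
  enters in \<open>act_mult\<close>.\<close>

abbreviation RG :: "('r, 'g \<Rightarrow> 'r) module" where
  "RG \<equiv> free_module R (carrier G)"

definition act :: "('g \<Rightarrow> 'r) \<Rightarrow> 's \<Rightarrow> 's" where
  "act a x = (\<Oplus>\<^bsub>M\<^esub>g\<in>carrier G. a g \<odot>\<^bsub>M\<^esub> \<phi> g x)"

lemma RG_carrier: "a \<in> carrier RG \<longleftrightarrow> a \<in> carrier G \<rightarrow>\<^sub>E carrier R"
  using finite_G by (auto simp: free_module_simps)

lemma RG_apply [simp]: "a \<in> carrier RG \<Longrightarrow> g \<in> carrier G \<Longrightarrow> a g \<in> carrier R"
  by (auto simp: RG_carrier)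

lemma \<phi>_mod_hom: "g \<in> carrier G \<Longrightarrow> \<phi> g \<in> mod_hom R M M"
  by (auto simp: mod_hom_def \<phi>_add \<phi>_smult)

lemma act_closed [simp]: "a \<in> carrier RG \<Longrightarrow> x \<in> carrier M \<Longrightarrow> act a x \<in> carrier M"
  unfolding act_def by (intro M.finsum_closed) auto

lemma act_mod_hom_left: 
  assumes x: "x \<in> carrier M" 
  shows "(\<lambda>a. act a x) \<in> mod_hom R RG M"
proof -
  have "act (a \<oplus>\<^bsub>RG\<^esub> b) x = act a x \<oplus>\<^bsub>M\<^esub> act b x" if "a \<in> carrier RG" "b \<in> carrier RG" for a b
  proof -
    have "act (a \<oplus>\<^bsub>RG\<^esub> b) x
        = (\<Oplus>\<^bsub>M\<^esub>g\<in>carrier G. a g \<odot>\<^bsub>M\<^esub> \<phi> g x \<oplus>\<^bsub>M\<^esub> b g \<odot>\<^bsub>M\<^esub> \<phi> g x)"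
      unfolding act_def using that x
      by (intro M.finsum_cong') (auto simp: free_module_simps(3) smult_l_distr)
    then show ?thesis
      unfolding act_def using that x by (simp add: Pi_iff)
  qed
  moreover have "act (r \<odot>\<^bsub>RG\<^esub> a) x = r \<odot>\<^bsub>M\<^esub> act a x" if "r \<in> carrier R" "a \<in> carrier RG" for r a
  proof -
    have "act (r \<odot>\<^bsub>RG\<^esub> a) x = (\<Oplus>\<^bsub>M\<^esub>g\<in>carrier G. r \<odot>\<^bsub>M\<^esub> (a g \<odot>\<^bsub>M\<^esub> \<phi> g x))"
      unfolding act_def using that x
      by (intro M.finsum_cong') (auto simp: free_module_simps(4) smult_assoc1)
    then show ?thesis
      unfolding act_def using that x finite_G by (simp add: finsum_smult_ldistr Pi_iff)
  qed
  ultimately show ?thesis using x by (auto simp: mod_hom_def)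
qed

lemma act_mod_hom_right:
  assumes a: "a \<in> carrier RG"
  shows "act a \<in> mod_hom R M M"
proof -
  have "act a (x \<oplus>\<^bsub>M\<^esub> y) = act a x \<oplus>\<^bsub>M\<^esub> act a y" if "x \<in> carrier M" "y \<in> carrier M" for x y
  proof -
    have "act a (x \<oplus>\<^bsub>M\<^esub> y) = (\<Oplus>\<^bsub>M\<^esub>g\<in>carrier G. a g \<odot>\<^bsub>M\<^esub> \<phi> g x \<oplus>\<^bsub>M\<^esub> a g \<odot>\<^bsub>M\<^esub> \<phi> g y)"
      unfolding act_def using that a by (intro M.finsum_cong') (auto simp: \<phi>_add smult_r_distr)
    then show ?thesis
      unfolding act_def using that a by (simp add: Pi_iff)
  qed
  moreover have "act a (r \<odot>\<^bsub>M\<^esub> x) = r \<odot>\<^bsub>M\<^esub> act a x" if "r \<in> carrier R" "x \<in> carrier M" for r x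
  proof -
    have "act a (r \<odot>\<^bsub>M\<^esub> x) = (\<Oplus>\<^bsub>M\<^esub>g\<in>carrier G. r \<odot>\<^bsub>M\<^esub> (a g \<odot>\<^bsub>M\<^esub> \<phi> g x))"
      unfolding act_def using that a
      by (intro M.finsum_cong') (auto simp: \<phi>_smult m_comm simp flip: smult_assoc1)
    then show ?thesis
      unfolding act_def using that a finite_G by (simp add: finsum_smult_ldistr Pi_iff)
  qed
  ultimately show ?thesis using a by (auto simp: mod_hom_def)
qed

lemma act_basis_vector:
  assumes "h \<in> carrier G" "x \<in> carrier M"
  shows "act (basis_vector R (carrier G) h) x = \<phi> h x"
proof -
  have "act (basis_vector R (carrier G) h) x
      = (\<Oplus>\<^bsub>M\<^esub>g\<in>carrier G. if h = g then \<phi> g x else \<zero>\<^bsub>M\<^esub>)"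
    unfolding act_def using assms by (intro M.finsum_cong') (auto simp: basis_vector_def)
  also have "\<dots> = \<phi> h x"
    using assms finite_G by (intro M.finsum_singleton) auto
  finally show ?thesis .
qed

lemma translate_closed:
  assumes "a \<in> carrier RG" "\<And>g. g \<in> carrier G \<Longrightarrow> \<tau> g \<in> carrier G"
  shows "(\<lambda>g\<in>carrier G. a (\<tau> g)) \<in> carrier RG"
  using assms by (auto simp: RG_carrier)

lemma bij_translate:
  assumes "h \<in> carrier G"
  shows "bij_betw (\<lambda>g. h \<otimes>\<^bsub>G\<^esub> g) (carrier G) (carrier G)"
    and "bij_betw (\<lambda>g. g \<otimes>\<^bsub>G\<^esub> h) (carrier G) (carrier G)"
proof -
  show "bij_betw (\<lambda>g. h \<otimes>\<^bsub>G\<^esub> g) (carrier G) (carrier G)"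
    by (rule bij_betwI[where g = "\<lambda>g. inv\<^bsub>G\<^esub> h \<otimes>\<^bsub>G\<^esub> g"])
      (use assms in \<open>auto simp flip: G.m_assoc\<close>)
  show "bij_betw (\<lambda>g. g \<otimes>\<^bsub>G\<^esub> h) (carrier G) (carrier G)"
    by (rule bij_betwI[where g = "\<lambda>g. g \<otimes>\<^bsub>G\<^esub> inv\<^bsub>G\<^esub> h"])
      (use assms in \<open>auto simp: G.m_assoc\<close>)
qed

lemma finsum_bij:
  assumes "bij_betw \<tau> (carrier G) (carrier G)" "f \<in> carrier G \<rightarrow> carrier M"
  shows "(\<Oplus>\<^bsub>M\<^esub>g\<in>carrier G. f (\<tau> g)) = (\<Oplus>\<^bsub>M\<^esub>g\<in>carrier G. f g)"
  using M.add.finprod_reindex[of f \<tau> "carrier G"] assms by (auto simp: bij_betw_def)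

text \<open>The translated function is the product \<open>h a\<close> in \<open>R[G]\<close>, so
  this is associativity \<open>(h a) x = h (a x)\<close>, obtained by replacing \<open>g\<close>
  with \<open>h g\<close> in the sum.\<close>

lemma act_translate_left:
  assumes "h \<in> carrier G" "a \<in> carrier RG" "x \<in> carrier M"
  shows "act (\<lambda>g\<in>carrier G. a (inv\<^bsub>G\<^esub> h \<otimes>\<^bsub>G\<^esub> g)) x = \<phi> h (act a x)" (is "act ?b x = _")
proof -
  have b: "?b \<in> carrier RG" using assms by (intro translate_closed) auto
  have "act ?b x = (\<Oplus>\<^bsub>M\<^esub>g\<in>carrier G. ?b (h \<otimes>\<^bsub>G\<^esub> g) \<odot>\<^bsub>M\<^esub> \<phi> (h \<otimes>\<^bsub>G\<^esub> g) x)"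
    unfolding act_def using assms b
    by (intro finsum_bij[OF bij_translate(1), symmetric]) (auto simp del: restrict_apply)
  also have "\<dots> = (\<Oplus>\<^bsub>M\<^esub>g\<in>carrier G. \<phi> h (a g \<odot>\<^bsub>M\<^esub> \<phi> g x))"
    using assms
    by (intro M.finsum_cong') (auto simp: \<phi>_mult \<phi>_smult simp flip: G.m_assoc)
  also have "\<dots> = \<phi> h (act a x)"
    unfolding act_def using assms
    by (intro mod_hom_finsum[OF module_axioms module_axioms \<phi>_mod_hom, symmetric]) auto
  finally show ?thesis .
qed

text \<open>The coefficient of \<open>g\<close> in \<open>a\<close> times the inverse of
  \<open>h\<close> is \<open>a (g h)\<close>, so right translation by \<open>h\<close> corresponds
  to first applying the inverse of \<open>h\<close> to \<open>x\<close>.\<close>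

lemma act_translate_right:
  assumes "h \<in> carrier G" "a \<in> carrier RG" "x \<in> carrier M"
  shows "act (\<lambda>g\<in>carrier G. a (g \<otimes>\<^bsub>G\<^esub> h)) x = act a (\<phi> (inv\<^bsub>G\<^esub> h) x)" (is "act ?b x = _")
proof -
  have "act a (\<phi> (inv\<^bsub>G\<^esub> h) x)
      = (\<Oplus>\<^bsub>M\<^esub>g\<in>carrier G. a (g \<otimes>\<^bsub>G\<^esub> h) \<odot>\<^bsub>M\<^esub> \<phi> (g \<otimes>\<^bsub>G\<^esub> h) (\<phi> (inv\<^bsub>G\<^esub> h) x))"
    unfolding act_def using assms
    by (intro finsum_bij[OF bij_translate(2), symmetric]) auto
  also have "\<dots> = (\<Oplus>\<^bsub>M\<^esub>g\<in>carrier G. a (g \<otimes>\<^bsub>G\<^esub> h) \<odot>\<^bsub>M\<^esub> \<phi> g x)"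
    using assms by (intro M.finsum_cong') (auto simp: G.m_assoc simp flip: \<phi>_mult)
  also have "\<dots> = act ?b x"
    unfolding act_def using assms by (intro M.finsum_cong') auto
  finally show ?thesis by simp
qed

text \<open>The convolution of \<open>a\<close> and \<open>b\<close> is the sum over
  \<open>h\<close> of \<open>a h\<close> times the left translate of \<open>b\<close> by
  \<open>h\<close>; linearity in the first argument and \<open>act_translate_left\<close> then
  evaluate it.\<close>

lemma act_mult:
  assumes a: "a \<in> carrier RG" and b: "b \<in> carrier RG" and x: "x \<in> carrier M"
  shows "act (a \<otimes>\<^bsub>group_ring R G\<^esub> b) x = act a (act b x)"
proof -
  interpret F: module R RG by (rule module_free)
  let ?t = "\<lambda>h. a h \<odot>\<^bsub>RG\<^esub> (\<lambda>g\<in>carrier G. b (inv\<^bsub>G\<^esub> h \<otimes>\<^bsub>G\<^esub> g))"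
  have t: "?t \<in> carrier G \<rightarrow> carrier RG"
    using a b by (auto intro!: translate_closed)
  have "finsum RG ?t (carrier G) g = (a \<otimes>\<^bsub>group_ring R G\<^esub> b) g" if g: "g \<in> carrier G" for g
  proof -
    \<comment> \<open>Evaluation at \<open>g\<close> is linear, which shows that the sum in
      \<open>RG\<close> is computed pointwise.\<close>
    have "(\<lambda>v. v g) \<in> mod_hom R RG (regular_module R)"
      using g by (auto simp: mod_hom_def free_module_simps(3,4))
    from mod_hom_finsum[OF F.module_axioms module_regular this t]
    have "finsum RG ?t (carrier G) g = (\<Oplus>h\<in>carrier G. ?t h g)" by simp
    also have "\<dots> = (\<Oplus>h\<in>carrier G. a h \<otimes> b (inv\<^bsub>G\<^esub> h \<otimes>\<^bsub>G\<^esub> g))"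
      using a b g by (intro R.finsum_cong') (auto simp: free_module_simps(4))
    finally show ?thesis using g by (simp add: group_ring_def)
  qed
  moreover have "finsum RG ?t (carrier G) \<in> carrier RG" using t by (rule F.M.finsum_closed)
  then have "finsum RG ?t (carrier G) \<in> extensional (carrier G)" by (auto simp: RG_carrier PiE_iff)
  ultimately have "a \<otimes>\<^bsub>group_ring R G\<^esub> b = finsum RG ?t (carrier G)"
    by (intro extensionalityI[of _ "carrier G"]) (auto simp: group_ring_def)
  then have "act (a \<otimes>\<^bsub>group_ring R G\<^esub> b) x = (\<Oplus>\<^bsub>M\<^esub>h\<in>carrier G. act (?t h) x)"
    using mod_hom_finsum[OF F.module_axioms module_axioms act_mod_hom_left[OF x] t] by simp
  also have "\<dots> = (\<Oplus>\<^bsub>M\<^esub>h\<in>carrier G. a h \<odot>\<^bsub>M\<^esub> \<phi> h (act b x))"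
    using a b x
    by (intro M.finsum_cong')
      (auto simp: mod_homD(3)[OF act_mod_hom_left] translate_closed act_translate_left)
  finally show ?thesis by (simp add: act_def)
qed

lemma group_ring_mult_closed:
  assumes "a \<in> carrier RG" "b \<in> carrier RG"
  shows "a \<otimes>\<^bsub>group_ring R G\<^esub> b \<in> carrier RG"
  using assms by (auto simp: group_ring_def RG_carrier PiE_iff intro!: R.finsum_closed)

context
  fixes p n
  assumes p: "Factorial_Ring.prime p" "[p] \<cdot> \<one> = \<zero>" "order G = p ^ n"
begin

text \<open>Take a fixed coset modulo the annihilator of \<open>x\<close>, for left translation on \<open>R[G]\<close>.\<close>

lemma p_group_nonzero_fixed:
  assumes x: "x \<in> carrier M" "x \<noteq> \<zero>\<^bsub>M\<^esub>"
  shows "\<exists>a\<in>carrier RG. act a x \<noteq> \<zero>\<^bsub>M\<^esub> \<and> (\<forall>g\<in>carrier G. \<phi> g (act a x) = act a x)"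
proof -
  interpret F: module R RG by (rule module_free)
  have zero: "submodule {\<zero>\<^bsub>M\<^esub>} R M" by (rule submoduleI) auto
  let ?U = "{a \<in> carrier RG. act a x \<in> {\<zero>\<^bsub>M\<^esub>}}"
  note hom = act_mod_hom_left[OF x(1)]
  have "\<exists>a\<in>carrier RG - ?U. \<forall>g\<in>carrier G.
    (\<lambda>h\<in>carrier G. a (inv\<^bsub>G\<^esub> g \<otimes>\<^bsub>G\<^esub> h)) \<ominus>\<^bsub>RG\<^esub> a \<in> ?U"
  proof (rule p_group_ring_fixed_coset[OF is_cring p(1,2) G.is_group p(3)])
    show "subgroup ?U (add_monoid RG)"
      by (rule submodule.axioms(1)[OF
            mod_hom_vimage_submodule[OF F.module_axioms module_axioms hom zero]])
    show "basis_vector R (carrier G) \<one>\<^bsub>G\<^esub> \<notin> ?U" using x by (simp add: act_basis_vector)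
    show "(\<lambda>h\<in>carrier G. a (inv\<^bsub>G\<^esub> g \<otimes>\<^bsub>G\<^esub> h)) \<in> ?U" if "g \<in> carrier G" "a \<in> ?U" for g a
      using that x by (auto simp: act_translate_left translate_closed
          mod_hom_zero[OF module_axioms module_axioms \<phi>_mod_hom])
  qed (auto simp: G.inv_mult_group G.m_assoc)
  then obtain a where a: "a \<in> carrier RG" "act a x \<noteq> \<zero>\<^bsub>M\<^esub>"
    and fix_a: "\<And>g. g \<in> carrier G \<Longrightarrow>
      act ((\<lambda>h\<in>carrier G. a (inv\<^bsub>G\<^esub> g \<otimes>\<^bsub>G\<^esub> h)) \<ominus>\<^bsub>RG\<^esub> a) x = \<zero>\<^bsub>M\<^esub>" by auto
  have "\<phi> g (act a x) = act a x" if g: "g \<in> carrier G" for g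
  proof -
    have "\<phi> g (act a x) \<ominus>\<^bsub>M\<^esub> act a x = \<zero>\<^bsub>M\<^esub>"
      using fix_a[OF g] mod_hom_minus[OF F.module_axioms module_axioms hom] g a x
      by (simp add: act_translate_left translate_closed)
    then show ?thesis
      using g a x by (simp add: M.add.inv_solve_right' a_minus_def)
  qed
  with a show ?thesis by blast
qed

text \<open>This says that \<open>M = W + IM\<close> implies \<open>M = W\<close>, for the augmentation ideal \<open>I\<close>.  It replaces the
  nilpotency of \<open>I\<close>: take a fixed coset modulo \<open>{a. aM \<subseteq> W}\<close>, for right translation.\<close>

lemma p_group_generating_submodule:
  assumes W: "submodule W R M" "\<And>g x. g \<in> carrier G \<Longrightarrow> x \<in> W \<Longrightarrow> \<phi> g x \<in> W"
    and gen: "\<And>N. \<lbrakk>submodule N R M; W \<subseteq> N;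
      \<And>g x. g \<in> carrier G \<Longrightarrow> x \<in> carrier M \<Longrightarrow> \<phi> g x \<ominus>\<^bsub>M\<^esub> x \<in> N\<rbrakk> \<Longrightarrow> carrier M \<subseteq> N"
  shows "W = carrier M"
proof (rule ccontr)
  assume contra: "W \<noteq> carrier M"
  interpret F: module R RG by (rule module_free)
  note WE = submoduleE[OF W(1)]
  let ?U = "{a \<in> carrier RG. \<forall>x\<in>carrier M. act a x \<in> W}"
  have "\<exists>a\<in>carrier RG - ?U. \<forall>g\<in>carrier G.
    (\<lambda>h\<in>carrier G. a (h \<otimes>\<^bsub>G\<^esub> g)) \<ominus>\<^bsub>RG\<^esub> a \<in> ?U"
  proof (rule p_group_ring_fixed_coset[OF is_cring p(1,2) G.is_group p(3)])
    have "submodule ?U R RG"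
    proof (rule F.submoduleI)
      show "\<zero>\<^bsub>RG\<^esub> \<in> ?U"
        using mod_hom_zero[OF F.module_axioms module_axioms act_mod_hom_left] submodule_zero[OF W(1)]
        by auto
      fix a assume a: "a \<in> ?U"
      show smult: "r \<odot>\<^bsub>RG\<^esub> a \<in> ?U" if "r \<in> carrier R" for r
        using that a mod_homD(3)[OF act_mod_hom_left] WE(4) by auto
      show "\<ominus>\<^bsub>RG\<^esub> a \<in> ?U"
        using smult[of "\<ominus> \<one>"] a F.smult_l_minus[of \<one> a] by simp
      fix b assume "b \<in> ?U"
      then show "a \<oplus>\<^bsub>RG\<^esub> b \<in> ?U"
        using a mod_homD(2)[OF act_mod_hom_left] WE(5) by auto
    qed auto
    then show "subgroup ?U (add_monoid RG)" by (rule submodule.axioms(1))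
    show "basis_vector R (carrier G) \<one>\<^bsub>G\<^esub> \<notin> ?U"
      using contra WE(1) by (auto simp: act_basis_vector)
    show "(\<lambda>h\<in>carrier G. a (h \<otimes>\<^bsub>G\<^esub> g)) \<in> ?U" if "g \<in> carrier G" "a \<in> ?U" for g a
      using that by (auto simp: act_translate_right intro!: translate_closed)
  qed (auto simp: G.m_assoc)
  then obtain a where a: "a \<in> carrier RG" "a \<notin> ?U"
    and fix_a: "\<And>g x. g \<in> carrier G \<Longrightarrow> x \<in> carrier M \<Longrightarrow>
      act ((\<lambda>h\<in>carrier G. a (h \<otimes>\<^bsub>G\<^esub> g)) \<ominus>\<^bsub>RG\<^esub> a) x \<in> W" by blast
  \<comment> \<open>Modulo \<open>W\<close>, right invariance of \<open>a\<close> says that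
    \<open>a\<close> kills every \<open>g x - x\<close>; it also maps \<open>W\<close> into
    \<open>W\<close>. By \<open>gen\<close> it maps all of \<open>M\<close> into \<open>W\<close>,
    contradicting that \<open>a\<close> is outside \<open>?U\<close>.\<close>
  have "carrier M \<subseteq> {x \<in> carrier M. act a x \<in> W}"
  proof (rule gen)
    show "submodule {x \<in> carrier M. act a x \<in> W} R M"
      by (rule mod_hom_vimage_submodule[OF module_axioms module_axioms act_mod_hom_right[OF a(1)] W(1)])
    show "W \<subseteq> {x \<in> carrier M. act a x \<in> W}"
      using WE(1,4) W(2) a(1) by (auto simp: act_def intro!: submodule_finsum[OF W(1)])
    fix g x assume g: "g \<in> carrier G" and x: "x \<in> carrier M"
    have "act a (\<phi> g x) \<ominus>\<^bsub>M\<^esub> act a x \<in> W"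
      \<comment> \<open>The inverse of \<open>g\<close> is inserted because right translation by
        \<open>h\<close> acts through the inverse of \<open>h\<close>.\<close>
      using fix_a[of "inv\<^bsub>G\<^esub> g" x] g x a(1)
        mod_hom_minus[OF F.module_axioms module_axioms act_mod_hom_left[OF x]]
      by (simp add: act_translate_right translate_closed[where \<tau> = "\<lambda>h. h \<otimes>\<^bsub>G\<^esub> inv\<^bsub>G\<^esub> g"])
    then show "\<phi> g x \<ominus>\<^bsub>M\<^esub> x \<in> {x \<in> carrier M. act a x \<in> W}"
      using g x mod_hom_minus[OF module_axioms module_axioms act_mod_hom_right[OF a(1)]] by simp
  qed
  with a show False by blast
qed

end

end

text \<open>Carries the action of \<open>R[G]\<close> through a linear map that is equivariant at
  \<open>x\<close>. It is meant for the map \<open>a\<close> to \<open>a\<close> \<theta> from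
  \<open>R[G]\<close> to \<open>S\<close>, where it gives \<open>(b a)\<close> \<theta>
  \<open>= b (a\<close> \<theta>\<open>)\<close>.\<close>

lemma (in linear_action) act_equivariant:
  assumes "module R N" "f \<in> mod_hom R M N" "a \<in> carrier RG" "x \<in> carrier M"
    and "\<And>g. g \<in> carrier G \<Longrightarrow> f (\<phi> g x) = \<psi> g (f x)"
  shows "f (act a x) = (\<Oplus>\<^bsub>N\<^esub>g\<in>carrier G. a g \<odot>\<^bsub>N\<^esub> \<psi> g (f x))"
proof -
  interpret N: module R N by fact
  have "f (act a x) = (\<Oplus>\<^bsub>N\<^esub>g\<in>carrier G. f (a g \<odot>\<^bsub>M\<^esub> \<phi> g x))"
    unfolding act_def using assms
    by (intro mod_hom_finsum[OF module_axioms N.module_axioms assms(2)]) auto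
  also have "\<dots> = (\<Oplus>\<^bsub>N\<^esub>g\<in>carrier G. a g \<odot>\<^bsub>N\<^esub> \<psi> g (f x))"
    using assms mod_homD[OF assms(2)] by (intro N.M.finsum_cong') (auto simp flip: assms(5))
  finally show ?thesis .
qed


section \<open>Quotients and tensor products\<close>

text \<open>Elements of a tensor product are handled below through representatives in the free
  module, for which a linear projection onto the quotient is enough.\<close>

lemma (in module) quotient_module_hom:
  assumes K: "submodule K R M"
  shows "(\<lambda>v. K +>\<^bsub>M\<^esub> v) \<in> mod_hom R M (quotient_module M K)"
    and "carrier (quotient_module M K) = (\<lambda>v. K +>\<^bsub>M\<^esub> v) ` carrier M"
proof -
  interpret K: abelian_subgroup K M
    by (intro abelian_subgroupI3 additive_subgroupI submodule.axioms(1)[OF K] module.axioms(2)[OF module_axioms])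
  show carr: "carrier (quotient_module M K) = (\<lambda>v. K +>\<^bsub>M\<^esub> v) ` carrier M"
    by (auto simp: quotient_module_def A_RCOSETS_def')
  \<comment> \<open>The union in the definition of scalar multiplication collapses: all
    representatives give the same coset, and \<open>v\<close> is one of them.\<close>
  have "K +>\<^bsub>M\<^esub> (a \<odot>\<^bsub>M\<^esub> v) = (\<Union>x\<in>K +>\<^bsub>M\<^esub> v. K +>\<^bsub>M\<^esub> (a \<odot>\<^bsub>M\<^esub> x))"
    if a: "a \<in> carrier R" and v: "v \<in> carrier M" for a v
  proof -
    have "K +>\<^bsub>M\<^esub> (a \<odot>\<^bsub>M\<^esub> x) = K +>\<^bsub>M\<^esub> (a \<odot>\<^bsub>M\<^esub> v)" if x: "x \<in> K +>\<^bsub>M\<^esub> v" for x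
    proof -
      obtain k where k: "k \<in> K" "x = k \<oplus>\<^bsub>M\<^esub> v" using x by (auto simp: a_r_coset_def')
      then have "a \<odot>\<^bsub>M\<^esub> x \<in> K +>\<^bsub>M\<^esub> (a \<odot>\<^bsub>M\<^esub> v)"
        using a v submoduleE(1,4)[OF K] by (auto simp: a_r_coset_def' smult_r_distr subset_iff)
      then show ?thesis
        using a v M.a_repr_independence[OF _ _ submodule.axioms(1)[OF K]] by auto
    qed
    then show ?thesis using K.a_rcos_self[OF v] by blast
  qed
  then show "(\<lambda>v. K +>\<^bsub>M\<^esub> v) \<in> mod_hom R M (quotient_module M K)"
    unfolding mod_hom_def carr
    by (auto simp: quotient_module_def K.a_rcos_sum)
qed

lemma tensor_kernel_submodule:
  assumes "module R M" "module R N"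
  shows "submodule (tensor_kernel R M N) R (free_module R (carrier M \<times> carrier N))"
proof -
  interpret M: module R M by fact
  interpret N: module R N by fact
  interpret F: module R "free_module R (carrier M \<times> carrier N)" by (rule M.module_free)
  show ?thesis
    unfolding tensor_kernel_def
    by (rule module_span_submodule[OF F.module_axioms])
      (auto simp: tensor_relations_def Let_def)
qed

text \<open>The universal property of the tensor product, stated on the free module together with
  vanishing on \<open>tensor_kernel\<close>, so that no map on cosets has to be defined.\<close>

lemma bilinear_lift:
  assumes "module R M" "module R N" "module R L"
    and h: "\<And>x y. \<lbrakk>x \<in> carrier M; y \<in> carrier N\<rbrakk> \<Longrightarrow> h x y \<in> carrier L"
    and add: "\<And>x x' y. \<lbrakk>x \<in> carrier M; x' \<in> carrier M; y \<in> carrier N\<rbrakk>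
        \<Longrightarrow> h (x \<oplus>\<^bsub>M\<^esub> x') y = h x y \<oplus>\<^bsub>L\<^esub> h x' y"
      "\<And>x y y'. \<lbrakk>x \<in> carrier M; y \<in> carrier N; y' \<in> carrier N\<rbrakk>
        \<Longrightarrow> h x (y \<oplus>\<^bsub>N\<^esub> y') = h x y \<oplus>\<^bsub>L\<^esub> h x y'"
    and smult: "\<And>a x y. \<lbrakk>a \<in> carrier R; x \<in> carrier M; y \<in> carrier N\<rbrakk>
        \<Longrightarrow> h (a \<odot>\<^bsub>M\<^esub> x) y = a \<odot>\<^bsub>L\<^esub> h x y"
      "\<And>a x y. \<lbrakk>a \<in> carrier R; x \<in> carrier M; y \<in> carrier N\<rbrakk>
        \<Longrightarrow> h x (a \<odot>\<^bsub>N\<^esub> y) = a \<odot>\<^bsub>L\<^esub> h x y"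
  obtains f where "f \<in> mod_hom R (free_module R (carrier M \<times> carrier N)) L"
    and "\<And>x y. \<lbrakk>x \<in> carrier M; y \<in> carrier N\<rbrakk>
      \<Longrightarrow> f (basis_vector R (carrier M \<times> carrier N) (x, y)) = h x y"
    and "\<And>v. v \<in> tensor_kernel R M N \<Longrightarrow> f v = \<zero>\<^bsub>L\<^esub>"
proof -
  interpret M: module R M by fact
  interpret N: module R N by fact
  interpret L: module R L by fact
  let ?F = "free_module R (carrier M \<times> carrier N)"
  let ?e = "\<lambda>x y. basis_vector R (carrier M \<times> carrier N) (x, y)"
  interpret F: module R ?F by (rule M.module_free)
  have "(\<lambda>(x, y). h x y) \<in> carrier M \<times> carrier N \<rightarrow> carrier L" using h by auto
  from L.free_module_lift[OF this] obtain f
    where f: "f \<in> mod_hom R ?F L"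
      and e: "\<And>b. b \<in> carrier M \<times> carrier N \<Longrightarrow>
        f (basis_vector R (carrier M \<times> carrier N) b) = (\<lambda>(x, y). h x y) b"
    by blast
  have fe: "f (?e x y) = h x y" if "x \<in> carrier M" "y \<in> carrier N" for x y
    using e[of "(x, y)"] that by simp
  note f_minus = mod_hom_minus[OF F.module_axioms L.module_axioms f]
  have "submodule {\<zero>\<^bsub>L\<^esub>} R L" by (rule L.submoduleI) auto
  then have "submodule {v \<in> carrier ?F. f v \<in> {\<zero>\<^bsub>L\<^esub>}} R ?F"
    by (rule mod_hom_vimage_submodule[OF F.module_axioms L.module_axioms f])
  moreover have "tensor_relations R M N \<subseteq> {v \<in> carrier ?F. f v \<in> {\<zero>\<^bsub>L\<^esub>}}"
    by (auto simp: tensor_relations_def Let_def f_minus mod_homD[OF f] fe h add smult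
        a_minus_def[of L] L.M.r_neg)
  ultimately have "tensor_kernel R M N \<subseteq> {v \<in> carrier ?F. f v \<in> {\<zero>\<^bsub>L\<^esub>}}"
    unfolding tensor_kernel_def by (rule module_span_minimal)
  then show ?thesis by (intro that[OF f fe]) auto
qed


section \<open>Galois extensions\<close>

context galois_extension
begin

sublocale linear_action R S G \<phi>
proof -
  interpret algebra R S by (rule algebra)
  interpret action: group_action G "carrier S" \<phi> by (rule action)
  interpret group G using action.group_hom by (rule group_hom.axioms(1))
  show "linear_action R S G \<phi>"
  proof
    show "\<phi> \<one>\<^bsub>G\<^esub> x = x" if "x \<in> carrier S" for x
      using that by (simp flip: action.id_eq_one)
    show "\<phi> g x \<in> carrier S" if "g \<in> carrier G" "x \<in> carrier S" for g x
      using that by (rule action.element_image) simp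
  qed (simp_all add: finite_group action.composition_rule action_linear
      ring_iso_memE(3)[OF action_ring_iso])
qed

sublocale S: cring S
  using algebra by (rule algebra.M_cring)

lemma smult_mult:
  assumes "r \<in> carrier R" "x \<in> carrier S" "y \<in> carrier S"
  shows "(r \<odot>\<^bsub>S\<^esub> x) \<otimes>\<^bsub>S\<^esub> y = r \<odot>\<^bsub>S\<^esub> (x \<otimes>\<^bsub>S\<^esub> y)"
    and "x \<otimes>\<^bsub>S\<^esub> (r \<odot>\<^bsub>S\<^esub> y) = r \<odot>\<^bsub>S\<^esub> (x \<otimes>\<^bsub>S\<^esub> y)"
proof -
  interpret algebra R S by (rule algebra)
  have *: "(r \<odot>\<^bsub>S\<^esub> x) \<otimes>\<^bsub>S\<^esub> y = r \<odot>\<^bsub>S\<^esub> (x \<otimes>\<^bsub>S\<^esub> y)" if "x \<in> carrier S" "y \<in> carrier S" for x y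
    using that assms by (simp add: smult_assoc2)
  show "x \<otimes>\<^bsub>S\<^esub> (r \<odot>\<^bsub>S\<^esub> y) = r \<odot>\<^bsub>S\<^esub> (x \<otimes>\<^bsub>S\<^esub> y)"
    using *[of y x] assms by (simp add: S.m_comm)
qed (use assms algebra.smult_assoc2[OF algebra] in auto)

lemma \<phi>_ring_hom:
  assumes "g \<in> carrier G"
  shows "\<phi> g \<one>\<^bsub>S\<^esub> = \<one>\<^bsub>S\<^esub>"
    and "\<lbrakk>x \<in> carrier S; y \<in> carrier S\<rbrakk> \<Longrightarrow> \<phi> g (x \<otimes>\<^bsub>S\<^esub> y) = \<phi> g x \<otimes>\<^bsub>S\<^esub> \<phi> g y"
  using ring_iso_memE[OF action_ring_iso[OF assms]] by auto

abbreviation SxS :: "('r, 's \<times> 's \<Rightarrow> 'r) module" where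
  "SxS \<equiv> free_module R (carrier S \<times> carrier S)"

abbreviation pair :: "'s \<Rightarrow> 's \<Rightarrow> 's \<times> 's \<Rightarrow> 'r" where
  "pair x y \<equiv> basis_vector R (carrier S \<times> carrier S) (x, y)"

abbreviation S_power :: "('r, 'g \<Rightarrow> 's) module" where
  "S_power \<equiv> direct_sum_module (carrier G) (\<lambda>_. S)"

text \<open>\<open>q\<close> is the Galois isomorphism composed with the projection from the free
  module. Bijectivity turns into surjectivity of \<open>q\<close> and the rule that vectors with
  equal images differ by an element of the tensor kernel.\<close>

lemma galois_map:
  obtains q where "q \<in> mod_hom R SxS S_power"
    and "\<And>x y. \<lbrakk>x \<in> carrier S; y \<in> carrier S\<rbrakk> \<Longrightarrow> q (pair x y) = (\<lambda>g\<in>carrier G. x \<otimes>\<^bsub>S\<^esub> \<phi> g y)"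
    and "q ` carrier SxS = carrier S_power"
    and "\<And>u v. \<lbrakk>u \<in> carrier SxS; v \<in> carrier SxS; q u = q v\<rbrakk> \<Longrightarrow> u \<ominus>\<^bsub>SxS\<^esub> v \<in> tensor_kernel R S S"
proof -
  interpret F: module R SxS by (rule module_free)
  let ?K = "tensor_kernel R S S"
  have K: "submodule ?K R SxS" by (rule tensor_kernel_submodule[OF module_axioms module_axioms])
  note q = F.quotient_module_hom[OF K, folded tensor_module_def]
  obtain f where f: "f \<in> mod_hom R (tensor_module R S S) S_power"
    "bij_betw f (carrier (tensor_module R S S)) (carrier S_power)"
    and pure: "\<And>x y. \<lbrakk>x \<in> carrier S; y \<in> carrier S\<rbrakk>
      \<Longrightarrow> f (pure_tensor R S S x y) = (\<lambda>g\<in>carrier G. x \<otimes>\<^bsub>S\<^esub> \<phi> g y)"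
    using galois unfolding mod_iso_def by blast
  show ?thesis
  proof (rule that[of "\<lambda>v. f (?K +>\<^bsub>SxS\<^esub> v)"])
    show "(\<lambda>v. f (?K +>\<^bsub>SxS\<^esub> v)) \<in> mod_hom R SxS S_power"
      using mod_homD[OF q(1)] mod_homD[OF f(1)] by (auto simp: mod_hom_def)
    show "f (?K +>\<^bsub>SxS\<^esub> pair x y) = (\<lambda>g\<in>carrier G. x \<otimes>\<^bsub>S\<^esub> \<phi> g y)"
      if "x \<in> carrier S" "y \<in> carrier S" for x y
      using pure[OF that] by (simp add: pure_tensor_def)
    show "(\<lambda>v. f (?K +>\<^bsub>SxS\<^esub> v)) ` carrier SxS = carrier S_power"
      using f(2) unfolding bij_betw_def q(2) by (simp add: image_image)
    fix u v assume uv: "u \<in> carrier SxS" "v \<in> carrier SxS"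
      and "f (?K +>\<^bsub>SxS\<^esub> u) = f (?K +>\<^bsub>SxS\<^esub> v)"
    then have "?K +>\<^bsub>SxS\<^esub> u = ?K +>\<^bsub>SxS\<^esub> v"
      using f(2) unfolding bij_betw_def q(2) by (auto dest: inj_onD)
    then have "u \<in> ?K +>\<^bsub>SxS\<^esub> v"
      using group.rcos_self[OF F.M.a_group _ submodule.axioms(1)[OF K]] uv
      by (auto simp: a_r_coset_def)
    then show "u \<ominus>\<^bsub>SxS\<^esub> v \<in> ?K"
      using uv F.submoduleE(1)[OF K]
      by (auto simp: a_r_coset_def' a_minus_def F.M.a_assoc F.M.r_neg subset_iff)
  qed
qed

text \<open>Nakayama gives \<open>r\<close> in \<open>J\<close> with \<open>(1 - r) S = 0\<close>;
  applied to the unit of \<open>S\<close>, injectivity of the structure map yields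
  \<open>r = 1\<close>.\<close>

lemma ideal_trivial:
  assumes J: "ideal J R"
    and JS: "\<And>H. \<lbrakk>submodule H R S; \<And>j x. j \<in> J \<Longrightarrow> x \<in> carrier S \<Longrightarrow> j \<odot>\<^bsub>S\<^esub> x \<in> H\<rbrakk>
      \<Longrightarrow> carrier S \<subseteq> H"
  shows "\<one>\<^bsub>R\<^esub> \<in> J"
proof -
  obtain r where r: "r \<in> J" "(\<one>\<^bsub>R\<^esub> \<ominus>\<^bsub>R\<^esub> r) \<odot>\<^bsub>S\<^esub> \<one>\<^bsub>S\<^esub> = \<zero>\<^bsub>S\<^esub>"
    using nakayama[OF finitely_generated J JS] by blast
  have rc: "r \<in> carrier R" using r(1) ideal.Icarr[OF J] by blast
  have "(\<one>\<^bsub>R\<^esub> \<ominus>\<^bsub>R\<^esub> r) \<odot>\<^bsub>S\<^esub> \<one>\<^bsub>S\<^esub> = \<zero>\<^bsub>R\<^esub> \<odot>\<^bsub>S\<^esub> \<one>\<^bsub>S\<^esub>"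
    using r(2) by simp
  then have "\<one>\<^bsub>R\<^esub> \<ominus>\<^bsub>R\<^esub> r = \<zero>\<^bsub>R\<^esub>"
    using inj_onD[OF extension] rc by simp
  then show ?thesis using r(1) rc by simp
qed

text \<open>Since \<open>s \<otimes> 1\<close> and \<open>1 \<otimes> s\<close> have the same image under the Galois isomorphism, they are equal.
  Applying \<open>a \<otimes> b \<mapsto> f(x a) b\<close> for a functional \<open>f\<close> gives \<open>f(x s) 1 = f(x) s\<close>, so the conductor
  \<open>{r. r s \<in> R 1}\<close> contains all values of functionals.  As \<open>S\<close> is projective, these generate the
  unit ideal.\<close>

lemma fixed_imp_scalar:
  assumes s: "s \<in> carrier S" "\<And>g. g \<in> carrier G \<Longrightarrow> \<phi> g s = s"
  shows "\<exists>r\<in>carrier R. s = r \<odot>\<^bsub>S\<^esub> \<one>\<^bsub>S\<^esub>"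
proof -
  define J where "J = {r \<in> carrier R. \<exists>t\<in>carrier R. r \<odot>\<^bsub>S\<^esub> s = t \<odot>\<^bsub>S\<^esub> \<one>\<^bsub>S\<^esub>}"
  obtain q where q: "q \<in> mod_hom R SxS S_power"
    "\<And>x y. \<lbrakk>x \<in> carrier S; y \<in> carrier S\<rbrakk> \<Longrightarrow> q (pair x y) = (\<lambda>g\<in>carrier G. x \<otimes>\<^bsub>S\<^esub> \<phi> g y)"
    "\<And>u v. \<lbrakk>u \<in> carrier SxS; v \<in> carrier SxS; q u = q v\<rbrakk> \<Longrightarrow> u \<ominus>\<^bsub>SxS\<^esub> v \<in> tensor_kernel R S S"
    by (rule galois_map) blast
  interpret F: module R SxS by (rule module_free)
  have "q (pair s \<one>\<^bsub>S\<^esub>) = q (pair \<one>\<^bsub>S\<^esub> s)"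
    using s by (auto simp: q(2) \<phi>_ring_hom(1) fun_eq_iff)
  then have swap: "pair s \<one>\<^bsub>S\<^esub> \<ominus>\<^bsub>SxS\<^esub> pair \<one>\<^bsub>S\<^esub> s \<in> tensor_kernel R S S"
    by (intro q(3)) auto
  have functional: "f x \<in> J" if f: "f \<in> mod_hom R S (regular_module R)" and x: "x \<in> carrier S" for f x
  proof -
    note fD = mod_homD[OF f, simplified]
    obtain \<beta> where \<beta>: "\<beta> \<in> mod_hom R SxS S"
      "\<And>a b. \<lbrakk>a \<in> carrier S; b \<in> carrier S\<rbrakk> \<Longrightarrow> \<beta> (pair a b) = f (x \<otimes>\<^bsub>S\<^esub> a) \<odot>\<^bsub>S\<^esub> b"
      "\<And>v. v \<in> tensor_kernel R S S \<Longrightarrow> \<beta> v = \<zero>\<^bsub>S\<^esub>"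
    proof (rule bilinear_lift[OF module_axioms module_axioms module_axioms,
          of "\<lambda>a b. f (x \<otimes>\<^bsub>S\<^esub> a) \<odot>\<^bsub>S\<^esub> b"])
      fix r a b assume "r \<in> carrier R" "a \<in> carrier S" "b \<in> carrier S"
      then show "f (x \<otimes>\<^bsub>S\<^esub> (r \<odot>\<^bsub>S\<^esub> a)) \<odot>\<^bsub>S\<^esub> b = r \<odot>\<^bsub>S\<^esub> (f (x \<otimes>\<^bsub>S\<^esub> a) \<odot>\<^bsub>S\<^esub> b)"
        "f (x \<otimes>\<^bsub>S\<^esub> a) \<odot>\<^bsub>S\<^esub> (r \<odot>\<^bsub>S\<^esub> b) = r \<odot>\<^bsub>S\<^esub> (f (x \<otimes>\<^bsub>S\<^esub> a) \<odot>\<^bsub>S\<^esub> b)"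
        using x by (simp_all add: smult_mult fD R.m_comm flip: smult_assoc1)
    qed (use x fD in \<open>auto simp: S.r_distr smult_l_distr smult_r_distr\<close>)
    have "\<beta> (pair s \<one>\<^bsub>S\<^esub>) = \<beta> (pair \<one>\<^bsub>S\<^esub> s)"
    proof -
      have "\<beta> (pair s \<one>\<^bsub>S\<^esub>) \<ominus>\<^bsub>S\<^esub> \<beta> (pair \<one>\<^bsub>S\<^esub> s) = \<zero>\<^bsub>S\<^esub>"
        using \<beta>(3)[OF swap] mod_hom_minus[OF F.module_axioms module_axioms \<beta>(1)] by simp
      then show ?thesis using mod_homD(1)[OF \<beta>(1)] by simp
    qed
    then have "f (x \<otimes>\<^bsub>S\<^esub> s) \<odot>\<^bsub>S\<^esub> \<one>\<^bsub>S\<^esub> = f x \<odot>\<^bsub>S\<^esub> s"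
      using s x by (simp add: \<beta>(2))
    then have "f x \<odot>\<^bsub>S\<^esub> s = f (x \<otimes>\<^bsub>S\<^esub> s) \<odot>\<^bsub>S\<^esub> \<one>\<^bsub>S\<^esub>" by (rule sym)
    moreover have "f x \<in> carrier R" "f (x \<otimes>\<^bsub>S\<^esub> s) \<in> carrier R" using fD(1) s(1) x by simp_all
    ultimately show ?thesis unfolding J_def by blast
  qed
  have "\<one>\<^bsub>R\<^esub> \<in> J"
  proof (rule ideal_trivial)
    show "ideal J R"
    proof (rule idealI_cring)
      show "\<zero>\<^bsub>R\<^esub> \<in> J" using s by (auto simp: J_def intro!: bexI[of _ "\<zero>\<^bsub>R\<^esub>"])
      fix a assume "a \<in> J"
      then obtain t where t: "a \<in> carrier R" "t \<in> carrier R" "a \<odot>\<^bsub>S\<^esub> s = t \<odot>\<^bsub>S\<^esub> \<one>\<^bsub>S\<^esub>"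
        by (auto simp: J_def)
      show "r \<otimes>\<^bsub>R\<^esub> a \<in> J" if "r \<in> carrier R" for r
        using t that s by (auto simp: J_def smult_assoc1 intro!: bexI[of _ "r \<otimes>\<^bsub>R\<^esub> t"])
      fix b assume "b \<in> J"
      then obtain u where "b \<in> carrier R" "u \<in> carrier R" "b \<odot>\<^bsub>S\<^esub> s = u \<odot>\<^bsub>S\<^esub> \<one>\<^bsub>S\<^esub>"
        by (auto simp: J_def)
      then show "a \<oplus>\<^bsub>R\<^esub> b \<in> J"
        using t s by (auto simp: J_def smult_l_distr intro!: bexI[of _ "t \<oplus>\<^bsub>R\<^esub> u"])
    qed (auto simp: J_def)
    fix H assume H: "submodule H R S" and JH: "\<And>j x. j \<in> J \<Longrightarrow> x \<in> carrier S \<Longrightarrow> j \<odot>\<^bsub>S\<^esub> x \<in> H"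
    \<comment> \<open>The coordinates of \<open>i x\<close> are functionals evaluated at
      \<open>x\<close>, hence in \<open>J\<close>; applying the retraction \<open>p\<close> writes
      \<open>x\<close> as an element of \<open>J S\<close>.\<close>
    obtain B :: "'s set" and i p where i: "i \<in> mod_hom R S (free_module R B)" and p: "p \<in> mod_hom R (free_module R B) S"
      and pi: "\<And>x. x \<in> carrier S \<Longrightarrow> p (i x) = x"
      using projective unfolding projective_module_def by blast
    show "carrier S \<subseteq> H"
    proof
      fix x assume x: "x \<in> carrier S"
      have "p (i x) \<in> H"
      proof (rule free_module_induct[of "i x" B J "\<lambda>v. p v \<in> H"])
        show "i x \<in> carrier (free_module R B)" using x mod_homD(1)[OF i] by blast
        show "i x b \<in> J" if b: "b \<in> B" for b
        proof (rule functional[of "\<lambda>x. i x b"])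
          show "(\<lambda>x. i x b) \<in> mod_hom R S (regular_module R)"
            using b mod_homD[OF i] by (auto simp: mod_hom_def free_module_simps PiE_iff)
        qed (rule x)
        show "p \<zero>\<^bsub>free_module R B\<^esub> \<in> H"
          using mod_hom_zero[OF module_free module_axioms p] submodule_zero[OF H] by simp
        show "p (u \<oplus>\<^bsub>free_module R B\<^esub> w) \<in> H"
          if "u \<in> carrier (free_module R B)" "w \<in> carrier (free_module R B)" "p u \<in> H" "p w \<in> H" for u w
          using that mod_homD(2)[OF p] submoduleE(5)[OF H] by simp
        show "p (a \<odot>\<^bsub>free_module R B\<^esub> basis_vector R B b) \<in> H" if "a \<in> carrier R" "a \<in> J" for a b
          using that mod_homD(1,3)[OF p] JH by simp
      qed
      then show "x \<in> H" using pi x by simp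
    qed
  qed
  then show ?thesis using s by (auto simp: J_def)
qed

text \<open>The trace is the action of the norm element, the sum of all group elements, so its
  properties are instances of those of \<open>act\<close>.\<close>

abbreviation tr :: "'s \<Rightarrow> 's" where
  "tr \<equiv> act (\<lambda>g\<in>carrier G. \<one>\<^bsub>R\<^esub>)"

lemma tr_eq: "x \<in> carrier S \<Longrightarrow> tr x = (\<Oplus>\<^bsub>S\<^esub>g\<in>carrier G. \<phi> g x)"
  unfolding act_def by (intro M.finsum_cong') auto

lemma tr_mod_hom: "tr \<in> mod_hom R S S"
  by (rule act_mod_hom_right) (auto simp: RG_carrier)

text \<open>Left translation fixes the norm element, so traces are \<open>G\<close>-fixed and
  \<open>fixed_imp_scalar\<close> applies.\<close>

lemma tr_scalar:
  assumes x: "x \<in> carrier S"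
  shows "\<exists>r\<in>carrier R. tr x = r \<odot>\<^bsub>S\<^esub> \<one>\<^bsub>S\<^esub>"
proof (rule fixed_imp_scalar)
  fix h assume h: "h \<in> carrier G"
  have "(\<lambda>g\<in>carrier G. (\<lambda>g\<in>carrier G. \<one>\<^bsub>R\<^esub>) (inv\<^bsub>G\<^esub> h \<otimes>\<^bsub>G\<^esub> g)) = (\<lambda>g\<in>carrier G. \<one>\<^bsub>R\<^esub>)"
    using h by (auto simp: fun_eq_iff)
  then show "\<phi> h (tr x) = tr x"
    using act_translate_left[OF h _ x, of "\<lambda>g\<in>carrier G. \<one>\<^bsub>R\<^esub>"] by (simp add: RG_carrier)
qed (use mod_homD(1)[OF tr_mod_hom] x in auto)

text \<open>If \<open>\<Sum>\<^sub>i a\<^sub>i \<otimes> b\<^sub>i\<close> is the preimage of the unit vector at \<open>1 \<in> G\<close>, then \<open>x = \<Sum>\<^sub>i tr(b\<^sub>i x) a\<^sub>i\<close>, so the trace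
  ideal \<open>J\<close> satisfies \<open>JS = S\<close>.\<close>

lemma trace_one:
  obtains \<theta> where "\<theta> \<in> carrier S" "tr \<theta> = \<one>\<^bsub>S\<^esub>"
proof -
  note trD = mod_homD[OF tr_mod_hom]
  define J where "J = {r \<in> carrier R. \<exists>x\<in>carrier S. tr x = r \<odot>\<^bsub>S\<^esub> \<one>\<^bsub>S\<^esub>}"
  obtain q where q: "q \<in> mod_hom R SxS S_power"
    "\<And>x y. \<lbrakk>x \<in> carrier S; y \<in> carrier S\<rbrakk> \<Longrightarrow> q (pair x y) = (\<lambda>g\<in>carrier G. x \<otimes>\<^bsub>S\<^esub> \<phi> g y)"
    "q ` carrier SxS = carrier S_power"
    by (rule galois_map) blast
  interpret F: module R SxS by (rule module_free)
  interpret D: module R S_power by (rule module_direct_sum[OF R.is_cring module_axioms])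
  have S_power: "d g \<in> carrier S" if "d \<in> carrier S_power" "g \<in> carrier G" for d g
    using that by (auto simp: direct_sum_module_simps)
  have "\<one>\<^bsub>R\<^esub> \<in> J"
  proof (rule ideal_trivial)
    show "ideal J R"
    proof (rule idealI_cring)
      show "\<zero>\<^bsub>R\<^esub> \<in> J"
        using mod_hom_zero[OF module_axioms module_axioms tr_mod_hom]
        by (auto simp: J_def intro!: bexI[of _ "\<zero>\<^bsub>S\<^esub>"])
      fix a assume "a \<in> J"
      then obtain x where x: "a \<in> carrier R" "x \<in> carrier S" "tr x = a \<odot>\<^bsub>S\<^esub> \<one>\<^bsub>S\<^esub>"
        by (auto simp: J_def)
      show "r \<otimes>\<^bsub>R\<^esub> a \<in> J" if "r \<in> carrier R" for r
        using x that trD(3) by (auto simp: J_def smult_assoc1 intro!: bexI[of _ "r \<odot>\<^bsub>S\<^esub> x"])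
      fix b assume "b \<in> J"
      then obtain y where "b \<in> carrier R" "y \<in> carrier S" "tr y = b \<odot>\<^bsub>S\<^esub> \<one>\<^bsub>S\<^esub>"
        by (auto simp: J_def)
      then show "a \<oplus>\<^bsub>R\<^esub> b \<in> J"
        using x trD(2) by (auto simp: J_def smult_l_distr intro!: bexI[of _ "x \<oplus>\<^bsub>S\<^esub> y"])
    qed (auto simp: J_def)
    fix H assume H: "submodule H R S" and JH: "\<And>j x. j \<in> J \<Longrightarrow> x \<in> carrier S \<Longrightarrow> j \<odot>\<^bsub>S\<^esub> x \<in> H"
    show "carrier S \<subseteq> H"
    proof
      fix x assume x: "x \<in> carrier S"
      \<comment> \<open>\<open>ev\<close> sends the image of a pure tensor of \<open>a\<close> and
        \<open>b\<close> to \<open>a tr(b x)\<close>, an element of \<open>J S\<close>, and sends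
        the unit vector \<delta> at the identity to \<open>x\<close>.\<close>
      define ev where "ev d = (\<Oplus>\<^bsub>S\<^esub>g\<in>carrier G. d g \<otimes>\<^bsub>S\<^esub> \<phi> g x)" for d
      have ev: "ev \<in> mod_hom R S_power S"
        unfolding mod_hom_def
      proof (intro CollectI conjI ballI funcsetI)
        show "ev d \<in> carrier S" if "d \<in> carrier S_power" for d
          unfolding ev_def using that x S_power by (intro M.finsum_closed) auto
        show "ev (d \<oplus>\<^bsub>S_power\<^esub> d') = ev d \<oplus>\<^bsub>S\<^esub> ev d'"
          if "d \<in> carrier S_power" "d' \<in> carrier S_power" for d d'
        proof -
          have "ev (d \<oplus>\<^bsub>S_power\<^esub> d')
              = (\<Oplus>\<^bsub>S\<^esub>g\<in>carrier G. d g \<otimes>\<^bsub>S\<^esub> \<phi> g x \<oplus>\<^bsub>S\<^esub> d' g \<otimes>\<^bsub>S\<^esub> \<phi> g x)"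
            unfolding ev_def using that x S_power
            by (intro M.finsum_cong') (auto simp: direct_sum_module_simps(3) S.l_distr)
          then show ?thesis unfolding ev_def using that x S_power by (simp add: Pi_iff)
        qed
        show "ev (r \<odot>\<^bsub>S_power\<^esub> d) = r \<odot>\<^bsub>S\<^esub> ev d" if "r \<in> carrier R" "d \<in> carrier S_power" for r d
        proof -
          have "ev (r \<odot>\<^bsub>S_power\<^esub> d) = (\<Oplus>\<^bsub>S\<^esub>g\<in>carrier G. r \<odot>\<^bsub>S\<^esub> (d g \<otimes>\<^bsub>S\<^esub> \<phi> g x))"
            unfolding ev_def using that x S_power
            by (intro M.finsum_cong') (auto simp: direct_sum_module_simps(4) smult_mult)
          then show ?thesis
            unfolding ev_def using that x S_power finite_G by (simp add: finsum_smult_ldistr Pi_iff)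
        qed
      qed
      have pure: "ev (q (pair a b)) \<in> H" if "a \<in> carrier S" "b \<in> carrier S" for a b
      proof -
        obtain r where r: "r \<in> carrier R" "tr (b \<otimes>\<^bsub>S\<^esub> x) = r \<odot>\<^bsub>S\<^esub> \<one>\<^bsub>S\<^esub>"
          using tr_scalar \<open>b \<in> carrier S\<close> x by blast
        have "ev (q (pair a b)) = (\<Oplus>\<^bsub>S\<^esub>g\<in>carrier G. a \<otimes>\<^bsub>S\<^esub> \<phi> g (b \<otimes>\<^bsub>S\<^esub> x))"
          unfolding ev_def using that x
          by (intro M.finsum_cong') (auto simp: q(2) \<phi>_ring_hom(2) S.m_assoc)
        also have "\<dots> = a \<otimes>\<^bsub>S\<^esub> tr (b \<otimes>\<^bsub>S\<^esub> x)"
          using that x finite_G by (simp add: tr_eq S.finsum_rdistr Pi_iff)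
        also have "\<dots> = r \<odot>\<^bsub>S\<^esub> a" using that r by (simp add: smult_mult)
        also have "\<dots> \<in> H" using r that x by (intro JH) (auto simp: J_def)
        finally show ?thesis .
      qed
      have "ev (q v) \<in> H" if "v \<in> carrier SxS" for v
      proof (rule free_module_induct[OF that, of UNIV "\<lambda>v. ev (q v) \<in> H"])
        show "ev (q \<zero>\<^bsub>SxS\<^esub>) \<in> H"
          using mod_hom_zero[OF F.module_axioms D.module_axioms q(1)]
            mod_hom_zero[OF D.module_axioms module_axioms ev] submodule_zero[OF H] by simp
        show "ev (q (u \<oplus>\<^bsub>SxS\<^esub> w)) \<in> H"
          if "u \<in> carrier SxS" "w \<in> carrier SxS" "ev (q u) \<in> H" "ev (q w) \<in> H" for u w
          using that mod_homD(1,2)[OF q(1)] mod_homD(2)[OF ev] submoduleE(5)[OF H] by simp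
        show "ev (q (a \<odot>\<^bsub>SxS\<^esub> basis_vector R (carrier S \<times> carrier S) b)) \<in> H"
          if "a \<in> carrier R" "b \<in> carrier S \<times> carrier S" for a b
          using that mod_homD(1,3)[OF q(1)] mod_homD(3)[OF ev] submoduleE(4)[OF H] pure by auto
      qed auto
      moreover define \<delta> where "\<delta> = (\<lambda>g\<in>carrier G. if g = \<one>\<^bsub>G\<^esub> then \<one>\<^bsub>S\<^esub> else \<zero>\<^bsub>S\<^esub>)"
      then have "\<delta> \<in> q ` carrier SxS"
        unfolding q(3) using finite_G by (auto simp: direct_sum_module_simps)
      moreover have "ev \<delta> = (\<Oplus>\<^bsub>S\<^esub>g\<in>carrier G. if \<one>\<^bsub>G\<^esub> = g then \<phi> g x else \<zero>\<^bsub>S\<^esub>)"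
        unfolding ev_def \<delta>_def using x by (intro M.finsum_cong') auto
      then have "ev \<delta> = x" 
        using x finite_G M.finsum_singleton[of "\<one>\<^bsub>G\<^esub>" "carrier G" "\<lambda>g. \<phi> g x"] by simp
      ultimately show "x \<in> H" by blast
    qed
  qed
  then show ?thesis using that by (auto simp: J_def)
qed

end

section \<open>Evaluation at an element of trace one\<close>

context galois_extension
begin

abbreviation translate :: "'g \<Rightarrow> ('g \<Rightarrow> 'r) \<Rightarrow> 'g \<Rightarrow> 'r" where
  "translate h a \<equiv> (\<lambda>g\<in>carrier G. a (inv\<^bsub>G\<^esub> h \<otimes>\<^bsub>G\<^esub> g))"

text \<open>This is the left regular representation; it makes the fixed vector lemma available
  inside \<open>R[G]\<close>.\<close>

lemma linear_action_translate: "linear_action R RG G translate"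
proof -
  interpret F: module R RG by (rule module_free)
  show ?thesis
  proof
    show "translate h a \<in> carrier RG" if "h \<in> carrier G" "a \<in> carrier RG" for h a
      using that by (intro translate_closed) auto
    show "translate \<one>\<^bsub>G\<^esub> a = a" if "a \<in> carrier RG" for a
      using that by (auto simp: RG_carrier fun_eq_iff PiE_iff extensional_def)
    show "translate (h \<otimes>\<^bsub>G\<^esub> k) a = translate h (translate k a)"
      if "h \<in> carrier G" "k \<in> carrier G" "a \<in> carrier RG" for h k a
      using that by (auto simp: fun_eq_iff G.inv_mult_group G.m_assoc)
  qed (auto simp: finite_G free_module_simps(3,4) fun_eq_iff)
qed

context
  fixes p n \<theta>
  assumes p: "Factorial_Ring.prime p" "[p] \<cdot>\<^bsub>R\<^esub> \<one>\<^bsub>R\<^esub> = \<zero>\<^bsub>R\<^esub>" "order G = p ^ n"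
    and \<theta>: "\<theta> \<in> carrier S" "tr \<theta> = \<one>\<^bsub>S\<^esub>"
begin

lemma act_eq_zero_imp_zero:
  assumes a: "a \<in> carrier RG" "act a \<theta> = \<zero>\<^bsub>S\<^esub>"
  shows "a = \<zero>\<^bsub>RG\<^esub>"
proof (rule ccontr)
  assume "a \<noteq> \<zero>\<^bsub>RG\<^esub>"
  interpret T: linear_action R RG G translate by (rule linear_action_translate)
  obtain b where b: "b \<in> carrier RG" "T.act b a \<noteq> \<zero>\<^bsub>RG\<^esub>"
    and fix_b: "\<And>g. g \<in> carrier G \<Longrightarrow> translate g (T.act b a) = T.act b a"
    using T.p_group_nonzero_fixed[OF p a(1) \<open>a \<noteq> _\<close>] by blast
  \<comment> \<open>\<open>c\<close> is the product \<open>b a\<close>. It stays in the left ideal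
    generated by \<open>a\<close>, so it still kills \<theta>, and its invariance under translation
    makes it a constant function.\<close>
  define c where "c = T.act b a"
  have c: "c \<in> carrier RG" using a b by (simp add: c_def)
  have c_const: "c g = c \<one>\<^bsub>G\<^esub>" if "g \<in> carrier G" for g
    using fun_cong[OF fix_b[OF that], of g] that by (simp add: c_def)
  let ?N = "\<lambda>g\<in>carrier G. \<one>\<^bsub>R\<^esub>"
  have r: "c \<one>\<^bsub>G\<^esub> \<in> carrier R" using c by simp
  have "c = c \<one>\<^bsub>G\<^esub> \<odot>\<^bsub>RG\<^esub> ?N"
  proof (rule extensionalityI[of _ "carrier G"])
    fix g assume g: "g \<in> carrier G"
    show "c g = (c \<one>\<^bsub>G\<^esub> \<odot>\<^bsub>RG\<^esub> ?N) g"
      using c_const[OF g] r g by (simp add: free_module_simps(4))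
  qed (use c in \<open>auto simp: RG_carrier PiE_iff free_module_simps(4)\<close>)
  then have "act c \<theta> = c \<one>\<^bsub>G\<^esub> \<odot>\<^bsub>S\<^esub> \<one>\<^bsub>S\<^esub>"
    using mod_homD(3)[OF act_mod_hom_left[OF \<theta>(1)] r, of ?N] \<theta>(2) by (simp add: RG_carrier)
  moreover have "act c \<theta> = (\<Oplus>\<^bsub>S\<^esub>g\<in>carrier G. b g \<odot>\<^bsub>S\<^esub> \<phi> g (act a \<theta>))"
    unfolding c_def
    by (rule T.act_equivariant[OF module_axioms act_mod_hom_left[OF \<theta>(1)] b(1) a(1)])
      (simp add: act_translate_left a \<theta>)
  then have "act c \<theta> = \<zero>\<^bsub>S\<^esub>"
    using a b by (simp add: mod_hom_zero[OF module_axioms module_axioms \<phi>_mod_hom] cong: M.finsum_cong)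
  ultimately have "c \<one>\<^bsub>G\<^esub> = \<zero>\<^bsub>R\<^esub>"
    using inj_onD[OF extension, of "c \<one>\<^bsub>G\<^esub>" "\<zero>\<^bsub>R\<^esub>"] r by simp
  then have "c g = \<zero>\<^bsub>R\<^esub>" if "g \<in> carrier G" for g
    using c_const[OF that] by simp
  then have "c = \<zero>\<^bsub>RG\<^esub>"
    using c by (intro extensionalityI[of _ "carrier G"])
      (auto simp: RG_carrier PiE_iff free_module_simps(2))
  with b(2) show False by (simp add: c_def)
qed

text \<open>Modulo \<open>IS\<close>, \<open>x = (tr \<theta>) x = \<Sum>\<^sub>g g(\<theta>) x\<close> is congruent to \<open>\<Sum>\<^sub>g \<theta> g\<^sup>-\<^sup>1(x) = (tr x) \<theta>\<close>.\<close>

lemma act_surj: "(\<lambda>a. act a \<theta>) ` carrier RG = carrier S"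
proof (rule p_group_generating_submodule[OF p])
  interpret F: module R RG by (rule module_free)
  note hom = act_mod_hom_left[OF \<theta>(1)]
  let ?W = "(\<lambda>a. act a \<theta>) ` carrier RG"
  show "submodule ?W R S"
  proof (rule submoduleI)
    show "\<zero>\<^bsub>S\<^esub> \<in> ?W"
      using mod_hom_zero[OF F.module_axioms module_axioms hom] F.M.zero_closed by (metis imageI)
    fix x assume "x \<in> ?W"
    then obtain a where a: "a \<in> carrier RG" "x = act a \<theta>" by blast
    show smult: "r \<odot>\<^bsub>S\<^esub> x \<in> ?W" if "r \<in> carrier R" for r
      using a that mod_homD(3)[OF hom that a(1)] by (intro image_eqI[of _ _ "r \<odot>\<^bsub>RG\<^esub> a"]) auto
    show "\<ominus>\<^bsub>S\<^esub> x \<in> ?W"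
      using smult[of "\<ominus>\<^bsub>R\<^esub> \<one>\<^bsub>R\<^esub>"] smult_l_minus[of "\<one>\<^bsub>R\<^esub>" x] a \<theta> by simp
    fix y assume "y \<in> ?W"
    then obtain b where b: "b \<in> carrier RG" "y = act b \<theta>" by blast
    show "x \<oplus>\<^bsub>S\<^esub> y \<in> ?W"
      using a b mod_homD(2)[OF hom a(1) b(1)] by (intro image_eqI[of _ _ "a \<oplus>\<^bsub>RG\<^esub> b"]) auto
  qed (use \<theta> in auto)
  show "\<phi> g x \<in> ?W" if "g \<in> carrier G" "x \<in> ?W" for g x
  proof -
    obtain a where a: "a \<in> carrier RG" "x = act a \<theta>" using \<open>x \<in> ?W\<close> by blast
    have "translate g a \<in> carrier RG" using \<open>g \<in> carrier G\<close> a by (intro translate_closed) auto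
    then show ?thesis
      using act_translate_left[OF \<open>g \<in> carrier G\<close> a(1) \<theta>(1)] a(2) by (metis imageI)
  qed
  fix N assume N: "submodule N R S" "?W \<subseteq> N"
    and diff: "\<And>g x. g \<in> carrier G \<Longrightarrow> x \<in> carrier S \<Longrightarrow> \<phi> g x \<ominus>\<^bsub>S\<^esub> x \<in> N"
  show "carrier S \<subseteq> N"
  proof
    fix x assume x: "x \<in> carrier S"
    obtain r where r: "r \<in> carrier R" "tr x = r \<odot>\<^bsub>S\<^esub> \<one>\<^bsub>S\<^esub>" using tr_scalar[OF x] by blast
    define y where "y g = \<phi> g \<theta> \<otimes>\<^bsub>S\<^esub> x" for g
    have y: "y g \<in> carrier S" if "g \<in> carrier G" for g using that \<theta> x by (simp add: y_def)
    have y': "\<phi> (inv\<^bsub>G\<^esub> g) (y g) = \<theta> \<otimes>\<^bsub>S\<^esub> \<phi> (inv\<^bsub>G\<^esub> g) x" if "g \<in> carrier G" for g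
      using that \<theta> x by (simp add: y_def \<phi>_ring_hom(2) flip: \<phi>_mult)
    have sum_y: "(\<Oplus>\<^bsub>S\<^esub>g\<in>carrier G. y g) = x"
      unfolding y_def using \<theta> x finite_G by (simp add: tr_eq Pi_iff flip: S.finsum_ldistr)
    \<comment> \<open>\<open>d\<close> collects the error of replacing each \<open>y g\<close> by
      its image under the inverse of \<open>g\<close>; every term has the form
      \<open>h z - z\<close>, so \<open>d\<close> lies in \<open>N\<close>.\<close>
    define d where "d = (\<Oplus>\<^bsub>S\<^esub>g\<in>carrier G. \<phi> (inv\<^bsub>G\<^esub> g) (y g) \<ominus>\<^bsub>S\<^esub> y g)"
    have d: "d \<in> N"
      unfolding d_def using y diff by (intro submodule_finsum[OF N(1)]) auto
    have dc: "d \<in> carrier S" using d submoduleE(1)[OF N(1)] by blast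
    \<comment> \<open>Summing over inverses gives the same trace, so the sum of the moved terms is
      \<theta> \<open>tr(x)\<close>, that is \<open>r\<close> \<theta>.\<close>
    have "bij_betw (\<lambda>g. inv\<^bsub>G\<^esub> g) (carrier G) (carrier G)"
      by (rule bij_betwI[where g = "\<lambda>g. inv\<^bsub>G\<^esub> g"]) auto
    from finsum_bij[OF this, of "\<lambda>g. \<phi> g x"] x
    have "(\<Oplus>\<^bsub>S\<^esub>g\<in>carrier G. \<phi> (inv\<^bsub>G\<^esub> g) x) = tr x" by (simp add: tr_eq)
    then have "r \<odot>\<^bsub>S\<^esub> \<theta> = \<theta> \<otimes>\<^bsub>S\<^esub> (\<Oplus>\<^bsub>S\<^esub>g\<in>carrier G. \<phi> (inv\<^bsub>G\<^esub> g) x)"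
      using r \<theta> by (simp add: smult_mult)
    also have "\<dots> = (\<Oplus>\<^bsub>S\<^esub>g\<in>carrier G. (\<phi> (inv\<^bsub>G\<^esub> g) (y g) \<ominus>\<^bsub>S\<^esub> y g) \<oplus>\<^bsub>S\<^esub> y g)"
    proof -
      have "(\<phi> (inv\<^bsub>G\<^esub> g) (y g) \<ominus>\<^bsub>S\<^esub> y g) \<oplus>\<^bsub>S\<^esub> y g = \<theta> \<otimes>\<^bsub>S\<^esub> \<phi> (inv\<^bsub>G\<^esub> g) x"
        if "g \<in> carrier G" for g
        using y[OF that] y'[OF that] that \<theta> x by (simp add: a_minus_def M.a_assoc M.l_neg)
      then show ?thesis using \<theta> x finite_G by (simp add: S.finsum_rdistr Pi_iff cong: M.finsum_cong)
    qed
    also have "\<dots> = d \<oplus>\<^bsub>S\<^esub> x"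
      unfolding d_def using y sum_y by (simp add: Pi_iff)
    finally have "x = r \<odot>\<^bsub>S\<^esub> \<theta> \<oplus>\<^bsub>S\<^esub> \<ominus>\<^bsub>S\<^esub> d"
      using dc x by (simp add: M.a_comm[of d x] M.a_assoc M.r_neg)
    moreover have "\<theta> \<in> N"
    proof -
      have "\<theta> = act (basis_vector R (carrier G) \<one>\<^bsub>G\<^esub>) \<theta>"
        using \<theta> by (simp add: act_basis_vector)
      moreover have "basis_vector R (carrier G) \<one>\<^bsub>G\<^esub> \<in> carrier RG" by simp
      ultimately show ?thesis using N(2) by (metis imageI subsetD)
    qed
    ultimately show "x \<in> N" using submoduleE(3,4,5)[OF N(1)] r(1) d by simp
  qed
qed

lemma bij_act: "bij_betw (\<lambda>a. act a \<theta>) (carrier RG) (carrier S)"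
proof -
  interpret F: module R RG by (rule module_free)
  note hom = act_mod_hom_left[OF \<theta>(1)]
  have "a = b" if "a \<in> carrier RG" "b \<in> carrier RG" "act a \<theta> = act b \<theta>" for a b
  proof -
    have "act (a \<ominus>\<^bsub>RG\<^esub> b) \<theta> = \<zero>\<^bsub>S\<^esub>"
      using that \<theta>(1) mod_hom_minus[OF F.module_axioms module_axioms hom]
      by (simp add: a_minus_def M.r_neg)
    then have "a \<ominus>\<^bsub>RG\<^esub> b = \<zero>\<^bsub>RG\<^esub>"
      using that by (intro act_eq_zero_imp_zero) auto
    then show ?thesis using that by (simp add: F.M.add.inv_solve_right' a_minus_def)
  qed
  then show ?thesis using act_surj by (auto simp: bij_betw_def inj_on_def)
qed

end

end

section \<open>The normal basis theorem\<close>

lemma group_ring_module_simps: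
  "carrier (group_ring_module S G \<phi>) = carrier S"
  "ring.add (group_ring_module S G \<phi>) = ring.add S"
  "a \<odot>\<^bsub>group_ring_module S G \<phi>\<^esub> s = (\<Oplus>\<^bsub>S\<^esub>g\<in>carrier G. a g \<odot>\<^bsub>S\<^esub> \<phi> g s)"
  "carrier (group_ring R G) = carrier (free_module R (carrier G))"
  "ring.add (group_ring R G) = ring.add (free_module R (carrier G))"
  by (simp_all add: group_ring_module_def group_ring_def)

theorem theorem1p3:
  fixes p :: nat
    and R :: "('r, 'k) ring_scheme"
    and S :: "('r, 's, 'm) module_scheme"
    and G :: "('g, 'l) monoid_scheme"
    and \<phi> :: "'g \<Rightarrow> 's \<Rightarrow> 's"
  assumes "Factorial_Ring.prime p"
    and "group G" and "finite (carrier G)" and "\<exists>n. order G = p ^ n"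
    and "cring R" and "\<forall>r\<in>carrier R. [p] \<cdot>\<^bsub>R\<^esub> r = \<zero>\<^bsub>R\<^esub>"
    and "galois_extension R S G \<phi>"
  shows "isomorphic_modules (group_ring R G)
           (group_ring_module S G \<phi>) (regular_module (group_ring R G))"
proof -
  interpret galois_extension R S G \<phi> by fact
  interpret F: module R RG by (rule module_free)
  obtain n where n: "order G = p ^ n" using assms(4) by blast
  have p: "[p] \<cdot>\<^bsub>R\<^esub> \<one>\<^bsub>R\<^esub> = \<zero>\<^bsub>R\<^esub>" using assms(6) by simp
  obtain \<theta> where \<theta>: "\<theta> \<in> carrier S" "tr \<theta> = \<one>\<^bsub>S\<^esub>" by (rule trace_one)
  note bij = bij_act[OF assms(1) p n \<theta>] and hom = act_mod_hom_left[OF \<theta>(1)]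
  \<comment> \<open>The isomorphism is required to go from \<open>S\<close> to \<open>R[G]\<close>,
    so it is the inverse of evaluation at \<theta>. Its linearity is checked on elements already
    written as \<open>a\<close> \<theta>, where \<open>act_mult\<close> turns \<open>a (b\<close>
    \<theta>\<open>)\<close> into \<open>(a b)\<close> \<theta>.\<close>
  define f where "f = inv_into (carrier RG) (\<lambda>a. act a \<theta>)"
  have f: "bij_betw f (carrier S) (carrier RG)"
    unfolding f_def using bij by (rule bij_betw_inv_into)
  have f_act: "f (act a \<theta>) = a" if "a \<in> carrier RG" for a
    unfolding f_def using bij_betw_inv_into_left[OF bij that] .
  have S: "\<exists>a\<in>carrier RG. x = act a \<theta>" if "x \<in> carrier S" for x
    using bij that unfolding bij_betw_def by blast
  have "f (x \<oplus>\<^bsub>S\<^esub> y) = f x \<oplus>\<^bsub>RG\<^esub> f y" if "x \<in> carrier S" "y \<in> carrier S" for x y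
  proof -
    obtain a b where "a \<in> carrier RG" "b \<in> carrier RG" "x = act a \<theta>" "y = act b \<theta>"
      using S[OF \<open>x \<in> _\<close>] S[OF \<open>y \<in> _\<close>] by blast
    then show ?thesis by (simp add: f_act flip: mod_homD(2)[OF hom])
  qed
  moreover have "f (act a x) = a \<otimes>\<^bsub>group_ring R G\<^esub> f x" if "a \<in> carrier RG" "x \<in> carrier S" for a x
  proof -
    obtain b where "b \<in> carrier RG" "x = act b \<theta>" using S[OF \<open>x \<in> _\<close>] by blast
    then show ?thesis
      using that \<theta> by (simp add: f_act group_ring_mult_closed flip: act_mult)
  qed
  ultimately have "f \<in> mod_iso (group_ring R G) (group_ring_module S G \<phi>) (regular_module (group_ring R G))"
    using f by (auto simp: mod_iso_def mod_hom_def group_ring_module_simps act_def bij_betw_def)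
  then show ?thesis unfolding isomorphic_modules_def by blast
qed

end
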